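(* Let $L$ be a frame. The following are equivalent. (1) All primes of $L$ are weakly covered. (2) All subspaces of $\mathsf{pt}(L)$ are sober. (3) The map $\mathsf{pt}:\mathsf{sp}[\mathsf{S}(L)]\to \mathcal{P}(\mathsf{pt}(L))$, $S\mapsto \mathsf{pt}(S)=\mathsf{pt}(L)\cap S$, is an isomorphism (of coframes). (4) The space $\mathsf{pt}(\mathsf{S}(L)^{op})$ is discrete. (5) The space $\mathsf{pt}(L)$ is $T_D$. (6) The coframe $\mathsf{sp}[\mathsf{S}(L)]$ is a Boolean algebra.
   Context: For a frame $L$, a prime is an element $p\neq 1$ such that $x\wedge y\leq p$ implies $x\leq p$ or $y\leq p$. $\mathsf{pt}(L)$ is the set of primes of $L$, topologized with open sets $\{p\in\mathsf{pt}(L): a\nleq p\}$, $a\in L$. A prime $p$ is weakly covered if, for every $P\subseteq \mathsf{pt}(L)$, $p=\bigwedge P$ implies $p\in P$. A sublocale of $L$ is a subset $S\subseteq L$ closed under arbitrary meets (so $1\in S$) such that $s\in S$ implies $x\to s\in S$ for all $x\in L$; it is itself a frame in the inherited order. $\mathsf{S}(L)$ is the coframe of all sublocales of $L$ ordered by inclusion, and $\mathsf{S}(L)^{op}$ is the opposite frame. For a sublocale $S$, the primes of the frame $S$ are exactly the elements of $\mathsf{pt}(L)\cap S$, and we write $\mathsf{pt}(S)=\mathsf{pt}(L)\cap S$. A frame is spatial if every element is a meet of primes; $\mathsf{sp}[\mathsf{S}(L)]$ is the collection of all spatial sublocales of $L$, ordered by inclusion; it is a coframe. $\mathcal{P}(\mathsf{pt}(L))$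 is the powerset of $\mathsf{pt}(L)$ (all subspaces), ordered by inclusion. A space is sober if every irreducible closed set is the closure of a unique point. A space $X$ is $T_D$ if every $x\in X$ has an open neighborhood $U$ with $U\setminus\{x\}$ open. *)

theory Defs
  imports "HOL-Analysis.Abstract_Topology" "HOL-Algebra.Complete_Lattice"
begin

section \<open>Frames and coframes\<close>

locale frame = complete_lattice L for L (structure) +
  assumes inf_sup_distrib:
    "\<lbrakk>a \<in> carrier L; B \<subseteq> carrier L\<rbrakk> \<Longrightarrow> a \<sqinter> \<Squnion> B = \<Squnion> ((\<lambda>b. a \<sqinter> b) ` B)"

abbreviation coframe :: "('a, 'b) gorder_scheme \<Rightarrow> bool"
  where "coframe L \<equiv> frame (inv_gorder L)"

definition coframe_hom ::
    "('a, 'c) gorder_scheme \<Rightarrow> ('b, 'd) gorder_scheme \<Rightarrow> ('a \<Rightarrow> 'b) set"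
  where "coframe_hom A B = {f \<in> carrier A \<rightarrow> carrier B.
    inf_pres A B f \<and> join_pres A B f \<and> f \<bottom>\<^bsub>A\<^esub> = \<bottom>\<^bsub>B\<^esub>}"

definition coframe_iso ::
    "('a, 'c) gorder_scheme \<Rightarrow> ('b, 'd) gorder_scheme \<Rightarrow> ('a \<Rightarrow> 'b) set"
  where "coframe_iso A B = {f \<in> coframe_hom A B.
    coframe A \<and> coframe B \<and> bij_betw f (carrier A) (carrier B)}"

locale boolean_lattice = bounded_lattice L for L (structure) +
  assumes meet_join_distrib:
    "\<lbrakk>x \<in> carrier L; y \<in> carrier L; z \<in> carrier L\<rbrakk>
      \<Longrightarrow> x \<sqinter> (y \<squnion> z) = (x \<sqinter> y) \<squnion> (x \<sqinter> z)"
  and complement_exists: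
    "x \<in> carrier L \<Longrightarrow> \<exists>y \<in> carrier L. x \<sqinter> y = \<bottom> \<and> x \<squnion> y = \<top>"


section \<open>Primes and the space of points\<close>

definition pt :: "('a, 'b) gorder_scheme \<Rightarrow> 'a set"
  where "pt L = {p \<in> carrier L. p \<noteq> \<top>\<^bsub>L\<^esub> \<and>
    (\<forall>x \<in> carrier L. \<forall>y \<in> carrier L. x \<sqinter>\<^bsub>L\<^esub> y \<sqsubseteq>\<^bsub>L\<^esub> p \<longrightarrow> x \<sqsubseteq>\<^bsub>L\<^esub> p \<or> y \<sqsubseteq>\<^bsub>L\<^esub> p)}"

definition pt_space :: "('a, 'b) gorder_scheme \<Rightarrow> 'a topology"
  where "pt_space L =
    topology (\<lambda>U. \<exists>a \<in> carrier L. U = {p \<in> pt L. \<not> a \<sqsubseteq>\<^bsub>L\<^esub> p})"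

definition weakly_covered :: "('a, 'b) gorder_scheme \<Rightarrow> 'a \<Rightarrow> bool"
  where "weakly_covered L p \<longleftrightarrow> p \<in> pt L \<and> (\<forall>P \<subseteq> pt L. p = \<Sqinter>\<^bsub>L\<^esub> P \<longrightarrow> p \<in> P)"

definition spatial :: "('a, 'b) gorder_scheme \<Rightarrow> bool"
  where "spatial L \<longleftrightarrow> (\<forall>a \<in> carrier L. \<exists>P \<subseteq> pt L. a = \<Sqinter>\<^bsub>L\<^esub> P)"


section \<open>Sublocales\<close>

definition himp :: "('a, 'b) gorder_scheme \<Rightarrow> 'a \<Rightarrow> 'a \<Rightarrow> 'a"
  where "himp L x y = \<Squnion>\<^bsub>L\<^esub> {z \<in> carrier L. z \<sqinter>\<^bsub>L\<^esub> x \<sqsubseteq>\<^bsub>L\<^esub> y}"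

definition is_sublocale :: "('a, 'b) gorder_scheme \<Rightarrow> 'a set \<Rightarrow> bool"
  where "is_sublocale L S \<longleftrightarrow> S \<subseteq> carrier L \<and> (\<forall>A \<subseteq> S. \<Sqinter>\<^bsub>L\<^esub> A \<in> S) \<and>
    (\<forall>x \<in> carrier L. \<forall>s \<in> S. himp L x s \<in> S)"

definition sublocales :: "('a, 'b) gorder_scheme \<Rightarrow> 'a set gorder"
  where "sublocales L = \<lparr>carrier = {S. is_sublocale L S}, eq = (=), le = (\<subseteq>)\<rparr>"

text \<open>A sublocale \<open>S\<close>, viewed as a frame in the inherited order, is \<open>L\<lparr>carrier := S\<rparr>\<close>.\<close>

definition spatial_sublocales :: "('a, 'b) gorder_scheme \<Rightarrow> 'a set gorder"
  where "spatial_sublocales L =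
    \<lparr>carrier = {S. is_sublocale L S \<and> spatial (L\<lparr>carrier := S\<rparr>)}, eq = (=), le = (\<subseteq>)\<rparr>"

definition powerset_order :: "'a set \<Rightarrow> 'a set gorder"
  where "powerset_order X = \<lparr>carrier = Pow X, eq = (=), le = (\<subseteq>)\<rparr>"


section \<open>Sober and \<open>T\<^sub>D\<close> spaces\<close>

definition irreducible_closed :: "'a topology \<Rightarrow> 'a set \<Rightarrow> bool"
  where "irreducible_closed X C \<longleftrightarrow> closedin X C \<and> C \<noteq> {} \<and>
    (\<forall>A B. closedin X A \<and> closedin X B \<and> C = A \<union> B \<longrightarrow> C = A \<or> C = B)"

definition sober_space :: "'a topology \<Rightarrow> bool"
  where "sober_space X \<longleftrightarrow>
    (\<forall>C. irreducible_closed X C \<longrightarrow> (\<exists>!x. x \<in> topspace X \<and> C = X closure_of {x}))"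

definition TD_space :: "'a topology \<Rightarrow> bool"
  where "TD_space X \<longleftrightarrow>
    (\<forall>x \<in> topspace X. \<exists>U. openin X U \<and> x \<in> U \<and> openin X (U - {x}))"


section \<open>The topologies and orders are well defined\<close>

lemma openin_pt_space:
  assumes "complete_lattice L"
  shows "openin (pt_space L) U \<longleftrightarrow> (\<exists>a \<in> carrier L. U = {p \<in> pt L. \<not> a \<sqsubseteq>\<^bsub>L\<^esub> p})"
proof -
  interpret complete_lattice L by fact
  have "istopology (\<lambda>U. \<exists>a \<in> carrier L. U = {p \<in> pt L. \<not> a \<sqsubseteq>\<^bsub>L\<^esub> p})"
    unfolding istopology_def
  proof (intro conjI allI impI)
    fix S T
    assume "\<exists>a \<in> carrier L. S = {p \<in> pt L. \<not> a \<sqsubseteq>\<^bsub>L\<^esub> p}"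
      and "\<exists>a \<in> carrier L. T = {p \<in> pt L. \<not> a \<sqsubseteq>\<^bsub>L\<^esub> p}"
    then obtain a b where ab: "a \<in> carrier L" "b \<in> carrier L"
      and S: "S = {p \<in> pt L. \<not> a \<sqsubseteq>\<^bsub>L\<^esub> p}" and T: "T = {p \<in> pt L. \<not> b \<sqsubseteq>\<^bsub>L\<^esub> p}"
      by blast
    have "a \<sqinter>\<^bsub>L\<^esub> b \<sqsubseteq>\<^bsub>L\<^esub> p \<longleftrightarrow> a \<sqsubseteq>\<^bsub>L\<^esub> p \<or> b \<sqsubseteq>\<^bsub>L\<^esub> p" if p: "p \<in> pt L" for p
    proof
      show "a \<sqsubseteq>\<^bsub>L\<^esub> p \<or> b \<sqsubseteq>\<^bsub>L\<^esub> p" if "a \<sqinter>\<^bsub>L\<^esub> b \<sqsubseteq>\<^bsub>L\<^esub> p"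
        using that p ab by (auto simp: pt_def)
      have "p \<in> carrier L" using p by (simp add: pt_def)
      then show "a \<sqinter>\<^bsub>L\<^esub> b \<sqsubseteq>\<^bsub>L\<^esub> p" if "a \<sqsubseteq>\<^bsub>L\<^esub> p \<or> b \<sqsubseteq>\<^bsub>L\<^esub> p"
        using that ab meet_left[of a b] meet_right[of a b] meet_closed[of a b]
        by (meson le_trans)
    qed
    then have "S \<inter> T = {p \<in> pt L. \<not> a \<sqinter>\<^bsub>L\<^esub> b \<sqsubseteq>\<^bsub>L\<^esub> p}"
      unfolding S T by blast
    then show "\<exists>c \<in> carrier L. S \<inter> T = {p \<in> pt L. \<not> c \<sqsubseteq>\<^bsub>L\<^esub> p}"
      using ab meet_closed by blast
  next
    fix \<K>
    assume K: "\<forall>K \<in> \<K>. \<exists>a \<in> carrier L. K = {p \<in> pt L. \<not> a \<sqsubseteq>\<^bsub>L\<^esub> p}"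
    define A where "A = {a \<in> carrier L. {p \<in> pt L. \<not> a \<sqsubseteq>\<^bsub>L\<^esub> p} \<in> \<K>}"
    have A: "A \<subseteq> carrier L" by (auto simp: A_def)
    have "\<Squnion>\<^bsub>L\<^esub> A \<sqsubseteq>\<^bsub>L\<^esub> p \<longleftrightarrow> (\<forall>a \<in> A. a \<sqsubseteq>\<^bsub>L\<^esub> p)" if p: "p \<in> pt L" for p
    proof
      have pc: "p \<in> carrier L" using p by (simp add: pt_def)
      show "\<forall>a \<in> A. a \<sqsubseteq>\<^bsub>L\<^esub> p" if "\<Squnion>\<^bsub>L\<^esub> A \<sqsubseteq>\<^bsub>L\<^esub> p"
        using that A pc sup_upper[OF A] sup_closed[OF A] by (meson le_trans subsetD)
      show "\<Squnion>\<^bsub>L\<^esub> A \<sqsubseteq>\<^bsub>L\<^esub> p" if "\<forall>a \<in> A. a \<sqsubseteq>\<^bsub>L\<^esub> p"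
        using that A pc by (auto intro: sup_least)
    qed
    moreover have "\<Union> \<K> = (\<Union>a \<in> A. {p \<in> pt L. \<not> a \<sqsubseteq>\<^bsub>L\<^esub> p})"
    proof -
      have "\<K> = (\<lambda>a. {p \<in> pt L. \<not> a \<sqsubseteq>\<^bsub>L\<^esub> p}) ` A"
        using K unfolding A_def image_def by (intro equalityI subsetI; simp) metis+
      then show ?thesis by simp
    qed
    ultimately have "\<Union> \<K> = {p \<in> pt L. \<not> \<Squnion>\<^bsub>L\<^esub> A \<sqsubseteq>\<^bsub>L\<^esub> p}"
      by blast
    then show "\<exists>c \<in> carrier L. \<Union> \<K> = {p \<in> pt L. \<not> c \<sqsubseteq>\<^bsub>L\<^esub> p}"
      using sup_closed[OF A] by blast
  qed
  then show ?thesis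
    by (simp add: pt_space_def)
qed

lemma topspace_pt_space:
  assumes "complete_lattice L"
  shows "topspace (pt_space L) = pt L"
proof -
  interpret complete_lattice L by fact
  have "\<not> \<top>\<^bsub>L\<^esub> \<sqsubseteq>\<^bsub>L\<^esub> p" if "p \<in> pt L" for p
    using that le_antisym[OF top_higher[of p] _ _ top_closed] by (auto simp: pt_def)
  then have "openin (pt_space L) (pt L)"
    unfolding openin_pt_space[OF assms] by (intro bexI[of _ "\<top>\<^bsub>L\<^esub>"]) auto
  then show ?thesis
    unfolding topspace_def openin_pt_space[OF assms] by blast
qed

lemma complete_lattice_sublocales:
  assumes "frame L"
  shows "complete_lattice (sublocales L)"
proof -
  interpret frame L by fact
  have po: "partial_order (sublocales L)"
    by standard (auto simp: sublocales_def)
  have top: "is_sublocale L (carrier L)"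
    unfolding is_sublocale_def himp_def by (auto intro!: inf_closed sup_closed)
  show ?thesis
  proof (rule partial_order.complete_lattice_criterion1[OF po])
    show "\<exists>g. greatest (sublocales L) g (carrier (sublocales L))"
      using top by (auto simp: greatest_def sublocales_def is_sublocale_def)
    fix A
    assume A: "A \<subseteq> carrier (sublocales L)" "A \<noteq> {}"
    then have sub: "\<And>S. S \<in> A \<Longrightarrow> is_sublocale L S"
      by (auto simp: sublocales_def)
    have "is_sublocale L (\<Inter> A)"
      unfolding is_sublocale_def
    proof (intro conjI allI impI ballI InterI)
      show "\<Inter> A \<subseteq> carrier L"
        using A(2) sub unfolding is_sublocale_def by blast
      show "\<Sqinter>\<^bsub>L\<^esub> B \<in> S" if "B \<subseteq> \<Inter> A" "S \<in> A" for B S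
        using that sub[OF that(2)] unfolding is_sublocale_def by (meson Inter_lower order_trans)
      show "himp L x s \<in> S" if "x \<in> carrier L" "s \<in> \<Inter> A" "S \<in> A" for x s S
        using that sub[OF that(3)] unfolding is_sublocale_def by (meson InterD)
    qed
    then have "greatest (sublocales L) (\<Inter> A) (Lower (sublocales L) A)"
      using A by (auto simp: greatest_def Lower_def sublocales_def)
    then show "\<exists>i. greatest (sublocales L) i (Lower (sublocales L) A)" ..
  qed
qed

end

theory Submission
  imports Defs
begin

text \<open>
Every condition is compared with the first one. Write \<open>meet_span L P\<close> for the set of all
meets of subsets of a set \<open>P\<close> of primes. Implication into a prime \<open>q\<close> gives
either \<open>q\<close> or the top element, so \<open>meet_span L P\<close> is a sublocale
(\<open>sublocale_meet_span\<close>), clearly the least one containing \<open>P\<close>. As the primes of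
a sublocale are the primes of \<open>L\<close> in it, the spatial sublocales are exactly the sets
\<open>meet_span L P\<close> (\<open>carrier_spatial_sublocales\<close>). A prime \<open>p\<close> is weakly
covered iff \<open>p \<in> meet_span L P\<close> forces \<open>p \<in> P\<close>, so all primes are weakly
covered iff \<open>P = pt L \<inter> meet_span L P\<close> for every set \<open>P\<close> of primes. This
is what the other conditions express.

\<^item> Soberness: an irreducible closed set \<open>C\<close> of a subspace has a prime as its meet, and
  \<open>C\<close> has a generic point iff it contains that prime. Conversely, if \<open>p = \<Sqinter>P\<close>, then
  \<open>P\<close> is irreducible in itself, and only \<open>p\<close> can be its generic point.

\<^item> The map \<open>pt\<close>: if all primes are weakly covered, \<open>meet_span L\<close> is its inverse, so
  it is an order isomorphism onto a power set and transports all lattice structure. Conversely,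
  if \<open>P = pt L \<inter> S\<close> for a sublocale \<open>S\<close>, then no prime outside \<open>P\<close> is a
  meet of elements of \<open>P\<close>.

\<^item> Discreteness: the points of the frame of sublocales are the two-element sublocales
  \<open>{p, \<top>}\<close> (\<open>pt_dual_sublocales\<close>), and its open sets correspond to the sets
  \<open>pt L - S\<close> for sublocales \<open>S\<close>. So discreteness again says that every set of primes
  has the form \<open>pt L \<inter> S\<close>.

\<^item> The \<open>T\<^sub>D\<close> axiom at \<open>p\<close> says that some \<open>a\<close> lies below all primes strictly
  above \<open>p\<close> but not below \<open>p\<close>, that is, \<open>p\<close> is not the meet of the primes
  strictly above it.

\<^item> Boolean algebra: power sets are Boolean. Conversely, a complement \<open>T\<close> of
  \<open>{p, \<top>}\<close> cannot contain \<open>p\<close> but must contain each prime strictly above \<open>p\<close>,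
  so \<open>p\<close> is not a meet of such primes.
\<close>

section \<open>Order isomorphisms\<close>

lemma complete_lattice_dual:
  assumes "complete_lattice L"
  shows "complete_lattice (inv_gorder L)"
proof -
  interpret complete_lattice L by fact
  interpret dual: partial_order "inv_gorder L" by (rule dual_order)
  show ?thesis
    by (rule dual.complete_latticeI) (simp_all add: inf_exists sup_exists)
qed

text \<open>A bijection that preserves and reflects the order carries over everything defined from the order
alone. The locale gives the form in which this is used: lattice structure is known on
\<open>B\<close> and is pulled back to \<open>A\<close>.\<close>

locale gorder_iso = A: partial_order A + B: partial_order B
  for A :: "('a, 'c) gorder_scheme" and B :: "('b, 'd) gorder_scheme" +
  fixes f :: "'a \<Rightarrow> 'b"
  assumes bij: "bij_betw f (carrier A) (carrier B)"
    and le_iff: "\<lbrakk>x \<in> carrier A; y \<in> carrier A\<rbrakk> \<Longrightarrow> f x \<sqsubseteq>\<^bsub>B\<^esub> f y \<longleftrightarrow> x \<sqsubseteq>\<^bsub>A\<^esub> y"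
begin

lemma carrier_image: "carrier B = f ` carrier A"
  using bij by (simp add: bij_betw_def)

lemma f_closed: "x \<in> carrier A \<Longrightarrow> f x \<in> carrier B"
  by (simp add: carrier_image)

lemma f_inj: "\<lbrakk>x \<in> carrier A; y \<in> carrier A; f x = f y\<rbrakk> \<Longrightarrow> x = y"
  using bij by (auto simp: bij_betw_def inj_on_def)

lemma dual_iso: "gorder_iso (inv_gorder A) (inv_gorder B) f"
proof -
  interpret dA: partial_order "inv_gorder A" by (rule A.dual_order)
  interpret dB: partial_order "inv_gorder B" by (rule B.dual_order)
  show ?thesis
    by unfold_locales (simp_all add: bij le_iff)
qed

lemma greatest_iff:
  assumes "S \<subseteq> carrier A" "x \<in> carrier A"
  shows "greatest B (f x) (f ` S) \<longleftrightarrow> greatest A x S"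
  using assms by (auto simp: greatest_def carrier_image le_iff subset_iff dest: f_inj)

lemma glb_iff:
  assumes "S \<subseteq> carrier A" "x \<in> carrier A"
  shows "greatest B (f x) (Lower B (f ` S)) \<longleftrightarrow> greatest A x (Lower A S)"
proof -
  have fS: "f ` S \<subseteq> carrier B"
    using assms(1) f_closed by auto
  have Lower_eq: "Lower C T = {l \<in> carrier C. \<forall>t \<in> T. l \<sqsubseteq>\<^bsub>C\<^esub> t}" if "T \<subseteq> carrier C"
    for C :: "('e, 'g) gorder_scheme" and T
    using that by (auto simp: Lower_def)
  have "f l \<sqsubseteq>\<^bsub>B\<^esub> f s \<longleftrightarrow> l \<sqsubseteq>\<^bsub>A\<^esub> s" if "l \<in> carrier A" "s \<in> S" for l s
    using that assms(1) le_iff by blast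
  then have "Lower B (f ` S) = f ` Lower A S"
    unfolding Lower_eq[OF fS] Lower_eq[OF assms(1)] carrier_image by auto
  then show ?thesis
    using greatest_iff[of "Lower A S" x] assms(2) by simp
qed

lemma lub_iff:
  assumes "S \<subseteq> carrier A" "x \<in> carrier A"
  shows "least B (f x) (Upper B (f ` S)) \<longleftrightarrow> least A x (Upper A S)"
  using gorder_iso.glb_iff[OF dual_iso, of S x] assms by simp

lemma complete_lattice_transfer:
  assumes "complete_lattice B"
  shows "complete_lattice A"
proof (rule A.complete_latticeI)
  interpret complete_lattice B by fact
  fix S assume S: "S \<subseteq> carrier A"
  then have fS: "f ` S \<subseteq> carrier B"
    using f_closed by auto
  show "\<exists>s. least A s (Upper A S)"
    using sup_exists[OF fS] lub_iff[OF S] by (metis carrier_image imageE least_closed Upper_closed)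
  show "\<exists>s. greatest A s (Lower A S)"
    using inf_exists[OF fS] glb_iff[OF S] by (metis carrier_image imageE greatest_closed Lower_closed)
qed

lemma f_inf:
  assumes B: "complete_lattice B" and S: "S \<subseteq> carrier A"
  shows "f (\<Sqinter>\<^bsub>A\<^esub> S) = \<Sqinter>\<^bsub>B\<^esub> (f ` S)"
proof -
  interpret A': complete_lattice A by (rule complete_lattice_transfer[OF B])
  interpret B': complete_lattice B by fact
  have "f ` S \<subseteq> carrier B"
    using S f_closed by auto
  then have "greatest B (\<Sqinter>\<^bsub>B\<^esub> (f ` S)) (Lower B (f ` S))"
    by (rule B'.inf_glb)
  moreover have "greatest B (f (\<Sqinter>\<^bsub>A\<^esub> S)) (Lower B (f ` S))"
    using S A'.inf_glb[OF S] by (simp add: glb_iff)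
  ultimately show ?thesis
    by (metis B.greatest_unique)
qed

lemma f_sup:
  assumes B: "complete_lattice B" and S: "S \<subseteq> carrier A"
  shows "f (\<Squnion>\<^bsub>A\<^esub> S) = \<Squnion>\<^bsub>B\<^esub> (f ` S)"
  using gorder_iso.f_inf[OF dual_iso complete_lattice_dual[OF B], of S] S by simp

lemma f_meet:
  "\<lbrakk>complete_lattice B; x \<in> carrier A; y \<in> carrier A\<rbrakk> \<Longrightarrow> f (x \<sqinter>\<^bsub>A\<^esub> y) = f x \<sqinter>\<^bsub>B\<^esub> f y"
  by (simp add: meet_def f_inf)

lemma f_join:
  "\<lbrakk>complete_lattice B; x \<in> carrier A; y \<in> carrier A\<rbrakk> \<Longrightarrow> f (x \<squnion>\<^bsub>A\<^esub> y) = f x \<squnion>\<^bsub>B\<^esub> f y"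
  by (simp add: join_def f_sup)

lemma f_bottom:
  assumes B: "complete_lattice B"
  shows "f \<bottom>\<^bsub>A\<^esub> = \<bottom>\<^bsub>B\<^esub>"
proof -
  interpret A': complete_lattice A by (rule complete_lattice_transfer[OF B])
  interpret B': complete_lattice B by fact
  have "\<bottom>\<^bsub>A\<^esub> = \<Squnion>\<^bsub>A\<^esub> {}" "\<bottom>\<^bsub>B\<^esub> = \<Squnion>\<^bsub>B\<^esub> {}"
    using A'.weak_sup_empty B'.weak_sup_empty
    unfolding A.eq_is_equal B.eq_is_equal by simp_all
  then show ?thesis
    using f_sup[OF B, of "{}"] by simp
qed

lemma f_top:
  assumes B: "complete_lattice B"
  shows "f \<top>\<^bsub>A\<^esub> = \<top>\<^bsub>B\<^esub>"
  using gorder_iso.f_bottom[OF dual_iso complete_lattice_dual[OF B]] by simp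

lemma frame_transfer:
  assumes "frame B"
  shows "frame A"
proof -
  interpret B': frame B by fact
  note B = B'.complete_lattice_axioms
  interpret A': complete_lattice A by (rule complete_lattice_transfer[OF B])
  show ?thesis
  proof unfold_locales
    fix a S assume a: "a \<in> carrier A" and S: "S \<subseteq> carrier A"
    have meets: "(\<lambda>b. a \<sqinter>\<^bsub>A\<^esub> b) ` S \<subseteq> carrier A"
      using a S by auto
    have "f (a \<sqinter>\<^bsub>A\<^esub> \<Squnion>\<^bsub>A\<^esub> S) = f a \<sqinter>\<^bsub>B\<^esub> \<Squnion>\<^bsub>B\<^esub> (f ` S)"
      using a S B by (simp add: f_meet f_sup)
    also have "\<dots> = \<Squnion>\<^bsub>B\<^esub> ((\<lambda>b. f a \<sqinter>\<^bsub>B\<^esub> b) ` f ` S)"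
      using a S f_closed by (intro B'.inf_sup_distrib) auto
    also have "(\<lambda>b. f a \<sqinter>\<^bsub>B\<^esub> b) ` f ` S = f ` (\<lambda>b. a \<sqinter>\<^bsub>A\<^esub> b) ` S"
      unfolding image_image using a S B by (intro image_cong) (auto simp: f_meet subset_iff)
    also have "\<Squnion>\<^bsub>B\<^esub> \<dots> = f (\<Squnion>\<^bsub>A\<^esub> ((\<lambda>b. a \<sqinter>\<^bsub>A\<^esub> b) ` S))"
      using meets B by (simp add: f_sup)
    finally show "a \<sqinter>\<^bsub>A\<^esub> \<Squnion>\<^bsub>A\<^esub> S = \<Squnion>\<^bsub>A\<^esub> ((\<lambda>b. a \<sqinter>\<^bsub>A\<^esub> b) ` S)"
      using a S meets by (auto intro: f_inj)
  qed
qed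

lemma boolean_lattice_transfer:
  assumes B: "complete_lattice B" and bool: "boolean_lattice B"
  shows "boolean_lattice A"
proof -
  interpret B': boolean_lattice B by fact
  interpret A': complete_lattice A by (rule complete_lattice_transfer[OF B])
  note pres = f_meet[OF B] f_join[OF B] f_bottom[OF B] f_top[OF B]
  show ?thesis
  proof unfold_locales
    fix x y z assume xyz: "x \<in> carrier A" "y \<in> carrier A" "z \<in> carrier A"
    then have "f (x \<sqinter>\<^bsub>A\<^esub> (y \<squnion>\<^bsub>A\<^esub> z)) = f ((x \<sqinter>\<^bsub>A\<^esub> y) \<squnion>\<^bsub>A\<^esub> (x \<sqinter>\<^bsub>A\<^esub> z))"
      by (simp add: pres B'.meet_join_distrib f_closed)
    then show "x \<sqinter>\<^bsub>A\<^esub> (y \<squnion>\<^bsub>A\<^esub> z) = (x \<sqinter>\<^bsub>A\<^esub> y) \<squnion>\<^bsub>A\<^esub> (x \<sqinter>\<^bsub>A\<^esub> z)"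
      using xyz by (auto intro: f_inj)
  next
    fix x assume x: "x \<in> carrier A"
    then obtain y where y: "y \<in> carrier A"
      and "f x \<sqinter>\<^bsub>B\<^esub> f y = \<bottom>\<^bsub>B\<^esub>" "f x \<squnion>\<^bsub>B\<^esub> f y = \<top>\<^bsub>B\<^esub>"
      using B'.complement_exists[OF f_closed[OF x]] by (auto simp: carrier_image)
    then have "f (x \<sqinter>\<^bsub>A\<^esub> y) = f \<bottom>\<^bsub>A\<^esub>" "f (x \<squnion>\<^bsub>A\<^esub> y) = f \<top>\<^bsub>A\<^esub>"
      using x by (simp_all add: pres)
    then have "x \<sqinter>\<^bsub>A\<^esub> y = \<bottom>\<^bsub>A\<^esub>" "x \<squnion>\<^bsub>A\<^esub> y = \<top>\<^bsub>A\<^esub>"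
      using x y by (auto intro!: f_inj simp del: A'.bottom_closed intro: A'.bottom_closed)
    then show "\<exists>y \<in> carrier A. x \<sqinter>\<^bsub>A\<^esub> y = \<bottom>\<^bsub>A\<^esub> \<and> x \<squnion>\<^bsub>A\<^esub> y = \<top>\<^bsub>A\<^esub>"
      using y by blast
  qed
qed

lemma coframe_iso_of_order_iso:
  assumes B: "complete_lattice B" and coB: "coframe B"
  shows "f \<in> coframe_iso A B"
proof -
  note A = complete_lattice_transfer[OF B]
  have "inf_pres A B f"
    using A B by (simp add: inf_pres_def f_inf)
  moreover have "join_pres A B f"
    using A B by (simp add: join_pres_def f_join)
  moreover have "coframe A"
    using gorder_iso.frame_transfer[OF dual_iso coB] .
  ultimately show ?thesis
    using B coB bij f_bottom f_closed by (auto simp: coframe_iso_def coframe_hom_def)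
qed

end

section \<open>Power sets\<close>

lemma powerset_order_simps:
  "carrier (powerset_order X) = Pow X"
  "A \<sqsubseteq>\<^bsub>powerset_order X\<^esub> B \<longleftrightarrow> A \<subseteq> B"
  by (simp_all add: powerset_order_def)

lemma partial_order_powerset: "partial_order (powerset_order X)"
  by standard (auto simp: powerset_order_def)

lemma powerset_lub: "\<A> \<subseteq> Pow X \<Longrightarrow> least (powerset_order X) (\<Union>\<A>) (Upper (powerset_order X) \<A>)"
  by (simp add: least_def Upper_def powerset_order_simps) blast

lemma powerset_glb:
  "\<A> \<subseteq> Pow X \<Longrightarrow> greatest (powerset_order X) (X \<inter> \<Inter>\<A>) (Lower (powerset_order X) \<A>)"
  by (simp add: greatest_def Lower_def powerset_order_simps) blast

lemma complete_lattice_powerset: "complete_lattice (powerset_order X)"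
  by (rule partial_order.complete_latticeI[OF partial_order_powerset])
    (auto simp: powerset_order_simps intro: powerset_lub powerset_glb)

lemma
  assumes "\<A> \<subseteq> Pow X"
  shows powerset_sup: "\<Squnion>\<^bsub>powerset_order X\<^esub> \<A> = \<Union>\<A>"
    and powerset_inf: "\<Sqinter>\<^bsub>powerset_order X\<^esub> \<A> = X \<inter> \<Inter>\<A>"
proof -
  interpret complete_lattice "powerset_order X"
    by (rule complete_lattice_powerset)
  have \<A>: "\<A> \<subseteq> carrier (powerset_order X)"
    using assms by (simp add: powerset_order_simps)
  show "\<Squnion>\<^bsub>powerset_order X\<^esub> \<A> = \<Union>\<A>"
    using least_unique[OF sup_lub[OF \<A>] powerset_lub[OF assms]] .
  show "\<Sqinter>\<^bsub>powerset_order X\<^esub> \<A> = X \<inter> \<Inter>\<A>"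
    using greatest_unique[OF inf_glb[OF \<A>] powerset_glb[OF assms]] .
qed

lemma powerset_join: "\<lbrakk>A \<subseteq> X; B \<subseteq> X\<rbrakk> \<Longrightarrow> A \<squnion>\<^bsub>powerset_order X\<^esub> B = A \<union> B"
  by (simp add: join_def powerset_sup)

lemma powerset_meet: "\<lbrakk>A \<subseteq> X; B \<subseteq> X\<rbrakk> \<Longrightarrow> A \<sqinter>\<^bsub>powerset_order X\<^esub> B = A \<inter> B"
  by (auto simp: meet_def powerset_inf)

text \<open>Under \<open>inv_gorder\<close>, the frame law reads \<open>a \<union> \<Inter>\<B> = (\<Inter>b \<in> \<B>. a \<union> b)\<close>.\<close>

lemma coframe_powerset: "coframe (powerset_order X)"
proof -
  interpret complete_lattice "inv_gorder (powerset_order X)"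
    by (rule complete_lattice_dual[OF complete_lattice_powerset])
  show ?thesis
  proof unfold_locales
    fix a \<B>
    assume "a \<in> carrier (inv_gorder (powerset_order X))" "\<B> \<subseteq> carrier (inv_gorder (powerset_order X))"
    then have a: "a \<subseteq> X" and \<B>: "\<B> \<subseteq> Pow X"
      by (auto simp: powerset_order_simps)
    have "(\<lambda>b. a \<squnion>\<^bsub>powerset_order X\<^esub> b) ` \<B> = (\<lambda>b. a \<union> b) ` \<B>"
      using a \<B> by (intro image_cong) (auto simp: powerset_join)
    moreover have "(\<lambda>b. a \<union> b) ` \<B> \<subseteq> Pow X"
      using a \<B> by auto
    ultimately show "a \<sqinter>\<^bsub>inv_gorder (powerset_order X)\<^esub> \<Squnion>\<^bsub>inv_gorder (powerset_order X)\<^esub> \<B> =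
        \<Squnion>\<^bsub>inv_gorder (powerset_order X)\<^esub> ((\<lambda>b. a \<sqinter>\<^bsub>inv_gorder (powerset_order X)\<^esub> b) ` \<B>)"
      using a \<B> unfolding meet_dual sup_dual by (auto simp: powerset_inf powerset_join)
  qed
qed

lemma boolean_lattice_powerset: "boolean_lattice (powerset_order X)"
proof -
  interpret complete_lattice "powerset_order X"
    by (rule complete_lattice_powerset)
  have bot: "\<bottom>\<^bsub>powerset_order X\<^esub> = {}"
    using bottom_lower[of "{}"] by (simp add: powerset_order_simps)
  have top: "\<top>\<^bsub>powerset_order X\<^esub> = X"
    using top_higher[of X] top_closed by (simp add: powerset_order_simps)
  show ?thesis
  proof unfold_locales
    fix x assume "x \<in> carrier (powerset_order X)"
    then show "\<exists>y \<in> carrier (powerset_order X). x \<sqinter>\<^bsub>powerset_order X\<^esub> y = \<bottom>\<^bsub>powerset_order X\<^esub> \<and>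
        x \<squnion>\<^bsub>powerset_order X\<^esub> y = \<top>\<^bsub>powerset_order X\<^esub>"
      by (intro bexI[of _ "X - x"]) (auto simp: powerset_order_simps powerset_meet powerset_join bot top)
  next
    fix x y z
    assume "x \<in> carrier (powerset_order X)" "y \<in> carrier (powerset_order X)"
      "z \<in> carrier (powerset_order X)"
    then have "x \<subseteq> X" "y \<subseteq> X" "z \<subseteq> X" "x \<inter> y \<subseteq> X" "x \<inter> z \<subseteq> X" "y \<union> z \<subseteq> X"
      by (auto simp: powerset_order_simps)
    then show "x \<sqinter>\<^bsub>powerset_order X\<^esub> (y \<squnion>\<^bsub>powerset_order X\<^esub> z) =
        (x \<sqinter>\<^bsub>powerset_order X\<^esub> y) \<squnion>\<^bsub>powerset_order X\<^esub> (x \<sqinter>\<^bsub>powerset_order X\<^esub> z)"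
      by (simp add: powerset_meet powerset_join Int_Un_distrib)
  qed
qed

section \<open>Frames and sublocales\<close>

text \<open>For a set \<open>P\<close> of primes this is the sublocale generated by \<open>P\<close>; it corresponds to
\<open>P\<close> regarded as a subspace of the space of points.\<close>

definition meet_span :: "('a, 'b) gorder_scheme \<Rightarrow> 'a set \<Rightarrow> 'a set"
  where "meet_span L P = {\<Sqinter>\<^bsub>L\<^esub> Q |Q. Q \<subseteq> P}"

context frame
begin

text \<open>Elements are compared through their lower sets, since meets and implications are characterised by
what lies below them.\<close>

lemma eq_by_lower: "\<lbrakk>x \<in> carrier L; y \<in> carrier L; \<And>z. z \<in> carrier L \<Longrightarrow> z \<sqsubseteq> x \<longleftrightarrow> z \<sqsubseteq> y\<rbrakk> \<Longrightarrow> x = y"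
  by (meson le_antisym le_refl)

lemma le_meet_iff:
  assumes "x \<in> carrier L" "y \<in> carrier L" "z \<in> carrier L"
  shows "z \<sqsubseteq> x \<sqinter> y \<longleftrightarrow> z \<sqsubseteq> x \<and> z \<sqsubseteq> y"
  using assms by (meson le_trans meet_closed meet_le meet_left meet_right)

lemma le_infimum_iff:
  assumes "A \<subseteq> carrier L" "z \<in> carrier L"
  shows "z \<sqsubseteq> \<Sqinter>A \<longleftrightarrow> (\<forall>a \<in> A. z \<sqsubseteq> a)"
  using assms by (meson inf_closed inf_greatest inf_lower le_trans subsetD)

lemma inf_empty: "\<Sqinter>{} = \<top>"
  using weak_inf_empty unfolding eq_is_equal .

lemma himp_closed [simp]: "himp L x y \<in> carrier L"
  unfolding himp_def by (rule sup_closed) auto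

lemma le_himp_iff:
  assumes x: "x \<in> carrier L" and y: "y \<in> carrier L" and z: "z \<in> carrier L"
  shows "z \<sqsubseteq> himp L x y \<longleftrightarrow> z \<sqinter> x \<sqsubseteq> y"
proof
  define Z where "Z = {z \<in> carrier L. z \<sqinter> x \<sqsubseteq> y}"
  have Z: "Z \<subseteq> carrier L" "himp L x y = \<Squnion>Z"
    by (auto simp: Z_def himp_def)
  show "z \<sqsubseteq> himp L x y" if "z \<sqinter> x \<sqsubseteq> y"
    unfolding Z(2) using that z by (intro sup_upper Z) (simp add: Z_def)
  have "x \<sqinter> \<Squnion>Z \<sqsubseteq> y"
    unfolding inf_sup_distrib[OF x Z(1)]
    by (rule sup_least) (auto simp: Z_def x y meet_comm)
  then have "himp L x y \<sqinter> x \<sqsubseteq> y"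
    by (simp add: Z(2) meet_comm)
  moreover have "z \<sqinter> x \<sqsubseteq> himp L x y \<sqinter> x" if "z \<sqsubseteq> himp L x y"
    using that x z le_trans[OF meet_left[OF z x] that]
    by (simp add: le_meet_iff meet_right)
  ultimately show "z \<sqinter> x \<sqsubseteq> y" if "z \<sqsubseteq> himp L x y"
    using that x y z by (meson himp_closed le_trans meet_closed)
qed

lemma pt_closed: "p \<in> pt L \<Longrightarrow> p \<in> carrier L"
  by (simp add: pt_def)

lemma pt_subset: "pt L \<subseteq> carrier L"
  by (auto simp: pt_def)

lemma top_notin_pt: "\<top> \<notin> pt L"
  by (simp add: pt_def)

lemma meet_le_pt_iff:
  assumes p: "p \<in> pt L" and xy: "x \<in> carrier L" "y \<in> carrier L"
  shows "x \<sqinter> y \<sqsubseteq> p \<longleftrightarrow> x \<sqsubseteq> p \<or> y \<sqsubseteq> p"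
proof
  show "x \<sqsubseteq> p \<or> y \<sqsubseteq> p" if "x \<sqinter> y \<sqsubseteq> p"
    using that p xy by (auto simp: pt_def)
  show "x \<sqinter> y \<sqsubseteq> p" if "x \<sqsubseteq> p \<or> y \<sqsubseteq> p"
    using that xy pt_closed[OF p] by (meson le_trans meet_closed meet_left meet_right)
qed

text \<open>A member of the span is the meet of a canonical set of generators, namely all those above it. So
nothing has to be chosen when meets of members are formed.\<close>

lemma mem_meet_spanD:
  assumes "P \<subseteq> carrier L" "a \<in> meet_span L P"
  shows "a \<in> carrier L" "a = \<Sqinter>{q \<in> P. a \<sqsubseteq> q}"
proof -
  obtain Q where Q: "Q \<subseteq> P" "a = \<Sqinter>Q"
    using assms by (auto simp: meet_span_def)
  then have QL: "Q \<subseteq> carrier L"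
    using assms by blast
  then show a: "a \<in> carrier L"
    using Q by simp
  let ?R = "{q \<in> P. a \<sqsubseteq> q}"
  have R: "?R \<subseteq> carrier L"
    using assms by blast
  have "\<Sqinter>?R \<sqsubseteq> a"
    unfolding Q(2) using Q QL R inf_lower[OF QL]
    by (intro inf_greatest inf_lower) auto
  moreover have "a \<sqsubseteq> \<Sqinter>?R"
    using a R by (simp add: le_infimum_iff)
  ultimately show "a = \<Sqinter>?R"
    using a R by (auto intro: le_antisym)
qed

lemma meet_span_closed: "P \<subseteq> carrier L \<Longrightarrow> meet_span L P \<subseteq> carrier L"
  using mem_meet_spanD(1) by blast

lemma subset_meet_span: "P \<subseteq> carrier L \<Longrightarrow> P \<subseteq> meet_span L P"
proof
  fix p assume "P \<subseteq> carrier L" "p \<in> P"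
  then have "p = \<Sqinter>{p}" "{p} \<subseteq> P"
    by auto
  then show "p \<in> meet_span L P"
    unfolding meet_span_def by blast
qed

lemma meet_span_mono: "P \<subseteq> Q \<Longrightarrow> meet_span L P \<subseteq> meet_span L Q"
  unfolding meet_span_def by blast

lemma sublocale_closed: "is_sublocale L S \<Longrightarrow> S \<subseteq> carrier L"
  by (simp add: is_sublocale_def)

lemma sublocale_inf: "\<lbrakk>is_sublocale L S; A \<subseteq> S\<rbrakk> \<Longrightarrow> \<Sqinter>A \<in> S"
  by (simp add: is_sublocale_def)

lemma sublocale_himp: "\<lbrakk>is_sublocale L S; x \<in> carrier L; s \<in> S\<rbrakk> \<Longrightarrow> himp L x s \<in> S"
  by (simp add: is_sublocale_def)

lemma sublocale_top: "is_sublocale L S \<Longrightarrow> \<top> \<in> S"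
  using sublocale_inf[of S "{}"] by (simp add: inf_empty)

lemma meet_span_least: "\<lbrakk>is_sublocale L S; P \<subseteq> S\<rbrakk> \<Longrightarrow> meet_span L P \<subseteq> S"
  by (auto simp: meet_span_def intro!: sublocale_inf)

text \<open>An element \<open>z\<close> lies below the left side iff \<open>z \<sqinter> x\<close> lies below each
\<open>q \<in> Q\<close>. As \<open>q\<close> is prime, this means \<open>z \<sqsubseteq> q\<close>, unless \<open>x \<sqsubseteq> q\<close>
already holds.\<close>

lemma himp_inf_primes:
  assumes x: "x \<in> carrier L" and Q: "Q \<subseteq> pt L"
  shows "himp L x (\<Sqinter>Q) = \<Sqinter>{q \<in> Q. \<not> x \<sqsubseteq> q}"
proof (rule eq_by_lower)
  have QL: "Q \<subseteq> carrier L" "{q \<in> Q. \<not> x \<sqsubseteq> q} \<subseteq> carrier L"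
    using Q pt_subset by auto
  then show "\<Sqinter>{q \<in> Q. \<not> x \<sqsubseteq> q} \<in> carrier L"
    by simp
  fix z assume z: "z \<in> carrier L"
  have "z \<sqsubseteq> himp L x (\<Sqinter>Q) \<longleftrightarrow> (\<forall>q \<in> Q. z \<sqinter> x \<sqsubseteq> q)"
    using x z QL by (simp add: le_himp_iff le_infimum_iff)
  also have "\<dots> \<longleftrightarrow> (\<forall>q \<in> Q. z \<sqsubseteq> q \<or> x \<sqsubseteq> q)"
    using x z Q by (meson meet_le_pt_iff subsetD)
  also have "\<dots> \<longleftrightarrow> z \<sqsubseteq> \<Sqinter>{q \<in> Q. \<not> x \<sqsubseteq> q}"
    using z QL by (auto simp: le_infimum_iff)
  finally show "z \<sqsubseteq> himp L x (\<Sqinter>Q) \<longleftrightarrow> z \<sqsubseteq> \<Sqinter>{q \<in> Q. \<not> x \<sqsubseteq> q}" .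
qed simp

lemma sublocale_meet_span:
  assumes P: "P \<subseteq> pt L"
  shows "is_sublocale L (meet_span L P)"
  unfolding is_sublocale_def
proof (intro conjI allI impI ballI)
  have PL: "P \<subseteq> carrier L"
    using P pt_subset by blast
  note [simp] = mem_meet_spanD(1)[OF PL]
  show "meet_span L P \<subseteq> carrier L"
    by (rule meet_span_closed[OF PL])
  show "\<Sqinter>A \<in> meet_span L P" if A: "A \<subseteq> meet_span L P" for A
  proof -
    have AL: "A \<subseteq> carrier L"
      using A by auto
    define Q where "Q = {q \<in> P. \<Sqinter>A \<sqsubseteq> q}"
    have QL: "Q \<subseteq> carrier L" "Q \<subseteq> P"
      using PL by (auto simp: Q_def)
    have "\<Sqinter>Q \<sqsubseteq> a" if a: "a \<in> A" for a
    proof -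
      have aL: "a \<in> carrier L" "\<Sqinter>A \<sqsubseteq> a"
        using a AL by (auto intro: inf_lower)
      have "q \<in> Q" if "q \<in> P" "a \<sqsubseteq> q" for q
        using that aL AL PL le_trans[of "\<Sqinter>A" a q] by (auto simp: Q_def)
      then have "\<Sqinter>Q \<sqsubseteq> \<Sqinter>{q \<in> P. a \<sqsubseteq> q}"
        using PL QL by (intro inf_greatest inf_lower) auto
      also have "\<dots> = a"
        using mem_meet_spanD(2)[OF PL] A a by force
      finally show ?thesis .
    qed
    then have "\<Sqinter>Q \<sqsubseteq> \<Sqinter>A"
      using QL AL by (simp add: le_infimum_iff)
    moreover have "\<Sqinter>A \<sqsubseteq> \<Sqinter>Q"
      using QL AL by (subst le_infimum_iff) (auto simp: Q_def)
    ultimately have "\<Sqinter>A = \<Sqinter>Q"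
      using QL AL by (auto intro: le_antisym)
    then show ?thesis
      using QL by (auto simp: meet_span_def)
  qed
  show "himp L x s \<in> meet_span L P" if x: "x \<in> carrier L" and s: "s \<in> meet_span L P" for x s
  proof -
    obtain Q where Q: "Q \<subseteq> P" "s = \<Sqinter>Q"
      using s by (auto simp: meet_span_def)
    then have "himp L x s = \<Sqinter>{q \<in> Q. \<not> x \<sqsubseteq> q}"
      using x P himp_inf_primes[of x Q] by auto
    then show ?thesis
      using Q unfolding meet_span_def by blast
  qed
qed

text \<open>The infimum is a \<open>SOME\<close> term over the restricted carrier, so its agreement with the infimum
of \<open>L\<close> rests on the uniqueness of greatest lower bounds.\<close>

lemma inf_sublocale:
  assumes S: "is_sublocale L S" and A: "A \<subseteq> S"
  shows "\<Sqinter>\<^bsub>L\<lparr>carrier := S\<rparr>\<^esub> A = \<Sqinter>A"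
proof -
  have SL: "S \<subseteq> carrier L" and AL: "A \<subseteq> carrier L"
    using sublocale_closed[OF S] A by auto
  have glb_iff: "greatest (L\<lparr>carrier := S\<rparr>) x (Lower (L\<lparr>carrier := S\<rparr>) A) \<longleftrightarrow>
      x \<in> S \<and> (\<forall>a \<in> A. x \<sqsubseteq> a) \<and> (\<forall>y \<in> S. (\<forall>a \<in> A. y \<sqsubseteq> a) \<longrightarrow> y \<sqsubseteq> x)" for x
  proof -
    have "Lower (L\<lparr>carrier := S\<rparr>) A = {x \<in> S. \<forall>a \<in> A. x \<sqsubseteq> a}"
      using A by (auto simp: Lower_def)
    then show ?thesis
      by (auto simp: greatest_def)
  qed
  have glb: "greatest (L\<lparr>carrier := S\<rparr>) (\<Sqinter>A) (Lower (L\<lparr>carrier := S\<rparr>) A)"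
    unfolding glb_iff
  proof (intro conjI ballI impI)
    show "\<Sqinter>A \<in> S"
      by (rule sublocale_inf[OF S A])
    show "\<Sqinter>A \<sqsubseteq> a" if "a \<in> A" for a
      by (rule inf_lower[OF AL that])
    show "y \<sqsubseteq> \<Sqinter>A" if "y \<in> S" "\<forall>a \<in> A. y \<sqsubseteq> a" for y
      using that SL AL by (subst le_infimum_iff) auto
  qed
  have unique: "y = \<Sqinter>A" if "greatest (L\<lparr>carrier := S\<rparr>) y (Lower (L\<lparr>carrier := S\<rparr>) A)" for y
  proof -
    have "y \<sqsubseteq> \<Sqinter>A" "\<Sqinter>A \<sqsubseteq> y" "y \<in> S" "\<Sqinter>A \<in> S"
      using that glb unfolding glb_iff by blast+
    then show ?thesis
      using SL by (blast intro: le_antisym)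
  qed
  show ?thesis
    unfolding inf_def[of "L\<lparr>carrier := S\<rparr>"] using glb unique by (rule some_equality)
qed

lemma top_sublocale:
  assumes S: "is_sublocale L S"
  shows "\<top>\<^bsub>L\<lparr>carrier := S\<rparr>\<^esub> = \<top>"
proof -
  have SL: "S \<subseteq> carrier L"
    by (rule sublocale_closed[OF S])
  have top: "greatest (L\<lparr>carrier := S\<rparr>) \<top> S"
    using SL sublocale_top[OF S] by (auto simp: greatest_def)
  have unique: "y = \<top>" if "greatest (L\<lparr>carrier := S\<rparr>) y S" for y
  proof -
    have "y \<sqsubseteq> \<top>" "\<top> \<sqsubseteq> y" "y \<in> carrier L"
      using that top SL by (auto simp: greatest_def)
    then show ?thesis
      by (intro le_antisym top_closed)
  qed
  have "\<top>\<^bsub>L\<lparr>carrier := S\<rparr>\<^esub> = (SOME x. greatest (L\<lparr>carrier := S\<rparr>) x S)"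
    by (simp add: top_def)
  also have "\<dots> = \<top>"
    using top unique by (rule some_equality)
  finally show ?thesis .
qed

text \<open>An element that is prime among the members of \<open>S\<close> is prime in \<open>L\<close>: if
\<open>x \<sqinter> y \<sqsubseteq> p\<close>, put \<open>s = (x \<rightarrow> p)\<close> and \<open>t = (s \<rightarrow> p)\<close>. Both are in
\<open>S\<close>, they satisfy \<open>y \<sqsubseteq> s\<close>, \<open>x \<sqsubseteq> t\<close> and \<open>t \<sqinter> s \<sqsubseteq> p\<close>, and
primeness in \<open>S\<close> applies to them.\<close>

lemma pt_sublocale:
  assumes S: "is_sublocale L S"
  shows "pt (L\<lparr>carrier := S\<rparr>) = pt L \<inter> S"
proof -
  have SL: "S \<subseteq> carrier L"
    by (rule sublocale_closed[OF S])
  have meet: "x \<sqinter>\<^bsub>L\<lparr>carrier := S\<rparr>\<^esub> y = x \<sqinter> y" if "x \<in> S" "y \<in> S" for x y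
    using that inf_sublocale[OF S, of "{x, y}"] by (simp add: meet_def)
  have mem: "p \<in> pt (L\<lparr>carrier := S\<rparr>) \<longleftrightarrow>
      p \<in> S \<and> p \<noteq> \<top> \<and> (\<forall>x \<in> S. \<forall>y \<in> S. x \<sqinter> y \<sqsubseteq> p \<longrightarrow> x \<sqsubseteq> p \<or> y \<sqsubseteq> p)" for p
    by (simp add: pt_def top_sublocale[OF S] meet cong: ball_cong_simp)
  show ?thesis
  proof (intro equalityI subsetI)
    fix p assume p: "p \<in> pt L \<inter> S"
    show "p \<in> pt (L\<lparr>carrier := S\<rparr>)"
      unfolding mem
    proof (intro conjI ballI impI)
      show "p \<in> S" "p \<noteq> \<top>"
        using p by (auto simp: pt_def)
      show "x \<sqsubseteq> p \<or> y \<sqsubseteq> p" if "x \<in> S" "y \<in> S" "x \<sqinter> y \<sqsubseteq> p" for x y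
        using that p SL meet_le_pt_iff[of p x y] by auto
    qed
  next
    fix p assume "p \<in> pt (L\<lparr>carrier := S\<rparr>)"
    then have pS: "p \<in> S" and ptop: "p \<noteq> \<top>"
      and prime: "\<And>x y. \<lbrakk>x \<in> S; y \<in> S; x \<sqinter> y \<sqsubseteq> p\<rbrakk> \<Longrightarrow> x \<sqsubseteq> p \<or> y \<sqsubseteq> p"
      unfolding mem by blast+
    have pL: "p \<in> carrier L"
      using pS SL by blast
    have "x \<sqsubseteq> p \<or> y \<sqsubseteq> p" if x: "x \<in> carrier L" and y: "y \<in> carrier L" and xy: "x \<sqinter> y \<sqsubseteq> p" for x y
    proof -
      define s t where "s = himp L x p" and "t = himp L s p"
      have st: "s \<in> S" "t \<in> S" "s \<in> carrier L" "t \<in> carrier L"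
        using pS x sublocale_himp[OF S] by (simp_all add: s_def t_def)
      have ys: "y \<sqsubseteq> s"
        using x y pL xy by (simp add: s_def le_himp_iff meet_comm)
      have "s \<sqinter> x \<sqsubseteq> p"
        using le_himp_iff[OF x pL st(3)] st(3) by (simp add: s_def)
      then have xt: "x \<sqsubseteq> t"
        using x pL st by (simp add: t_def le_himp_iff meet_comm)
      have "t \<sqinter> s \<sqsubseteq> p"
        using le_himp_iff[OF st(3) pL st(4)] st(4) by (simp add: t_def)
      then have "t \<sqsubseteq> p \<or> s \<sqsubseteq> p"
        using st by (intro prime)
      then show ?thesis
        using xt ys x y st pL by (meson le_trans)
    qed
    then show "p \<in> pt L \<inter> S"
      using pS pL ptop by (auto simp: pt_def)
  qed
qed

lemma spatial_sublocale_iff: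
  assumes S: "is_sublocale L S"
  shows "spatial (L\<lparr>carrier := S\<rparr>) \<longleftrightarrow> S = meet_span L (pt L \<inter> S)"
proof -
  have "spatial (L\<lparr>carrier := S\<rparr>) \<longleftrightarrow> (\<forall>a \<in> S. \<exists>P \<subseteq> pt L \<inter> S. a = \<Sqinter>P)"
    unfolding spatial_def pt_sublocale[OF S] by (simp add: inf_sublocale[OF S] cong: conj_cong)
  also have "\<dots> \<longleftrightarrow> S \<subseteq> meet_span L (pt L \<inter> S)"
    unfolding meet_span_def subset_iff by simp metis
  also have "\<dots> \<longleftrightarrow> S = meet_span L (pt L \<inter> S)"
    by (metis meet_span_least[OF S Int_lower2] subset_antisym subset_refl)
  finally show ?thesis .
qed

text \<open>A sublocale is spatial iff it is the span of its primes. A span is spatial although it may have more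
primes than its generators, because the additional ones are meets of generators.\<close>

lemma carrier_spatial_sublocales: "carrier (spatial_sublocales L) = meet_span L ` Pow (pt L)"
proof (intro equalityI subsetI)
  fix S assume "S \<in> carrier (spatial_sublocales L)"
  then have "is_sublocale L S" "spatial (L\<lparr>carrier := S\<rparr>)"
    by (simp_all add: spatial_sublocales_def)
  then have "S = meet_span L (pt L \<inter> S)"
    by (rule spatial_sublocale_iff[THEN iffD1])
  then show "S \<in> meet_span L ` Pow (pt L)"
    by blast
next
  fix S assume "S \<in> meet_span L ` Pow (pt L)"
  then obtain P where P: "P \<subseteq> pt L" "S = meet_span L P"
    by blast
  have S: "is_sublocale L S"
    using P sublocale_meet_span by simp
  have "P \<subseteq> pt L \<inter> S"
    using P subset_meet_span pt_subset by blast
  then have "S \<subseteq> meet_span L (pt L \<inter> S)"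
    unfolding P(2) by (rule meet_span_mono)
  then have "S = meet_span L (pt L \<inter> S)"
    using meet_span_least[OF S] by blast
  then show "S \<in> carrier (spatial_sublocales L)"
    using S by (simp add: spatial_sublocales_def spatial_sublocale_iff)
qed

lemma partial_order_spatial_sublocales: "partial_order (spatial_sublocales L)"
  by standard (auto simp: spatial_sublocales_def)

lemma weakly_covered_iff:
  assumes "p \<in> pt L"
  shows "weakly_covered L p \<longleftrightarrow> (\<forall>P \<subseteq> pt L. p \<in> meet_span L P \<longrightarrow> p \<in> P)"
  using assms unfolding weakly_covered_def meet_span_def by blast

lemma weakly_covered_pt_meet_span:
  assumes "\<forall>p \<in> pt L. weakly_covered L p" "P \<subseteq> pt L"
  shows "pt L \<inter> meet_span L P = P"
proof
  show "pt L \<inter> meet_span L P \<subseteq> P"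
    using assms weakly_covered_iff by blast
  show "P \<subseteq> pt L \<inter> meet_span L P"
    using assms(2) subset_meet_span[of P] pt_subset by blast
qed

end

section \<open>The space of points\<close>

context frame
begin

text \<open>The closure of \<open>p\<close> consists of the primes above \<open>p\<close>. So a suitable neighbourhood of
\<open>p\<close> is given by an \<open>a\<close> below all primes strictly above \<open>p\<close> and not below
\<open>p\<close>; the best candidate is the meet of the primes strictly above \<open>p\<close>.\<close>

lemma TD_space_pt_iff: "TD_space (pt_space L) \<longleftrightarrow> (\<forall>p \<in> pt L. weakly_covered L p)"
proof (intro iffI ballI)
  fix p assume TD: "TD_space (pt_space L)" and p: "p \<in> pt L"
  then obtain U where "openin (pt_space L) U" "p \<in> U" "openin (pt_space L) (U - {p})"
    unfolding TD_space_def topspace_pt_space[OF complete_lattice_axioms] by blast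
  then obtain a b where a: "a \<in> carrier L" "U = {q \<in> pt L. \<not> a \<sqsubseteq> q}"
    and b: "b \<in> carrier L" "U - {p} = {q \<in> pt L. \<not> b \<sqsubseteq> q}" and pU: "p \<in> U"
    unfolding openin_pt_space[OF complete_lattice_axioms] by blast
  have ap: "\<not> a \<sqsubseteq> p" and bp: "b \<sqsubseteq> p"
    using a b pU p by blast+
  have "p \<in> P" if P: "P \<subseteq> pt L" "p = \<Sqinter>P" for P
  proof (rule ccontr)
    assume pP: "p \<notin> P"
    have PL: "P \<subseteq> carrier L"
      using P pt_subset by blast
    have "a \<sqsubseteq> q" if q: "q \<in> P" for q
    proof -
      have "b \<sqsubseteq> q"
        using bp inf_lower[OF PL q] b(1) pt_closed[OF p] PL q
        unfolding P(2)[symmetric] by (blast intro: le_trans)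
      then show ?thesis
        using a(2) b(2) q P pP by blast
    qed
    then have "a \<sqsubseteq> p"
      using a PL P by (simp add: le_infimum_iff)
    then show False
      using ap by contradiction
  qed
  then show "weakly_covered L p"
    using p by (simp add: weakly_covered_def)
next
  assume wc: "\<forall>p \<in> pt L. weakly_covered L p"
  have "\<exists>U. openin (pt_space L) U \<and> p \<in> U \<and> openin (pt_space L) (U - {p})" if p: "p \<in> pt L" for p
  proof -
    define P where "P = {q \<in> pt L. p \<sqsubseteq> q \<and> q \<noteq> p}"
    define a where "a = \<Sqinter>P"
    have PL: "P \<subseteq> pt L" "P \<subseteq> carrier L"
      using pt_subset by (auto simp: P_def)
    have pL: "p \<in> carrier L" and a: "a \<in> carrier L"
      using p PL by (auto simp: a_def pt_closed)
    have "p \<sqsubseteq> a"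
      unfolding a_def using PL pL by (subst le_infimum_iff) (auto simp: P_def)
    moreover have "p \<noteq> a"
      using wc p PL unfolding weakly_covered_def a_def P_def by blast
    ultimately have ap: "\<not> a \<sqsubseteq> p"
      using pL a le_antisym by blast
    have above: "a \<sqsubseteq> q" if "q \<in> pt L" "p \<sqsubseteq> q" "q \<noteq> p" for q
      unfolding a_def using that PL by (intro inf_lower) (auto simp: P_def)
    let ?U = "{q \<in> pt L. \<not> a \<sqsubseteq> q}"
    have "?U - {p} = {q \<in> pt L. \<not> a \<sqinter> p \<sqsubseteq> q}"
      using above a pL by (auto simp: meet_le_pt_iff)
    moreover have "a \<sqinter> p \<in> carrier L"
      using a pL by simp
    ultimately have "openin (pt_space L) (?U - {p})"
      unfolding openin_pt_space[OF complete_lattice_axioms] by blast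
    moreover have "openin (pt_space L) ?U"
      unfolding openin_pt_space[OF complete_lattice_axioms] using a by blast
    moreover have "p \<in> ?U"
      using ap p by simp
    ultimately show ?thesis
      by blast
  qed
  then show "TD_space (pt_space L)"
    unfolding TD_space_def topspace_pt_space[OF complete_lattice_axioms] by blast
qed

lemma closedin_pt_space:
  "closedin (pt_space L) C \<longleftrightarrow> (\<exists>a \<in> carrier L. C = {q \<in> pt L. a \<sqsubseteq> q})"
  unfolding closedin_def topspace_pt_space[OF complete_lattice_axioms]
    openin_pt_space[OF complete_lattice_axioms]
  by (rule iffI; (elim conjE)?; elim bexE; intro conjI bexI; blast?)

lemma closedin_pt_subspace:
  assumes "Y \<subseteq> pt L"
  shows "closedin (subtopology (pt_space L) Y) C \<longleftrightarrow> (\<exists>a \<in> carrier L. C = {q \<in> Y. a \<sqsubseteq> q})"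
proof -
  have "{q \<in> pt L. a \<sqsubseteq> q} \<inter> Y = {q \<in> Y. a \<sqsubseteq> q}" for a
    using assms by blast
  then show ?thesis
    unfolding closedin_subtopology closedin_pt_space by metis
qed

lemma closure_of_pt_subspace:
  assumes Y: "Y \<subseteq> pt L" and y: "y \<in> Y"
  shows "subtopology (pt_space L) Y closure_of {y} = {q \<in> Y. y \<sqsubseteq> q}"
proof
  let ?X = "subtopology (pt_space L) Y" and ?C = "{q \<in> Y. y \<sqsubseteq> q}"
  have yL: "y \<in> carrier L"
    using Y y pt_closed by blast
  then have "closedin ?X ?C"
    using closedin_pt_subspace[OF Y] by blast
  then show "?X closure_of {y} \<subseteq> ?C"
    using y yL by (intro closure_of_minimal) auto
  obtain a where a: "a \<in> carrier L" "?X closure_of {y} = {q \<in> Y. a \<sqsubseteq> q}"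
    using closedin_closure_of[of ?X "{y}"] unfolding closedin_pt_subspace[OF Y] by blast
  have "y \<in> ?X closure_of {y}"
    using y Y topspace_pt_space[OF complete_lattice_axioms]
    by (intro closure_of_subset[THEN subsetD]) auto
  then have "a \<sqsubseteq> y"
    using a by blast
  then show "?C \<subseteq> ?X closure_of {y}"
    unfolding a(2) using a(1) yL Y pt_closed le_trans by blast
qed

text \<open>If \<open>p = \<Sqinter>P\<close> is prime, then the subspace \<open>P\<close> is irreducible: its closed sets are cut out
by elements \<open>a\<close>, and \<open>a \<sqsubseteq> p\<close> iff \<open>a\<close> cuts out all of \<open>P\<close>. A generic
point of \<open>P\<close> lies below all of \<open>P\<close> and belongs to \<open>P\<close>, so it is \<open>p\<close>.
In the other direction, the same computation shows that the meet of an irreducible closed set is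
prime, and weak covering puts it into the set.\<close>

lemma sober_subspaces_pt_iff:
  "(\<forall>Y \<subseteq> pt L. sober_space (subtopology (pt_space L) Y)) \<longleftrightarrow> (\<forall>p \<in> pt L. weakly_covered L p)"
proof (intro iffI ballI)
  fix p assume sober: "\<forall>Y \<subseteq> pt L. sober_space (subtopology (pt_space L) Y)" and p: "p \<in> pt L"
  have pL: "p \<in> carrier L"
    by (rule pt_closed[OF p])
  have "p \<in> P" if P: "P \<subseteq> pt L" "p = \<Sqinter>P" for P
  proof -
    let ?X = "subtopology (pt_space L) P"
    have PL: "P \<subseteq> carrier L"
      using P pt_subset by blast
    have le_p: "a \<sqsubseteq> p \<longleftrightarrow> (\<forall>q \<in> P. a \<sqsubseteq> q)" if "a \<in> carrier L" for a
      unfolding P(2) using that PL by (rule le_infimum_iff[rotated])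
    have "irreducible_closed ?X P"
      unfolding irreducible_closed_def closedin_pt_subspace[OF P(1)]
    proof (intro conjI allI impI)
      show "\<exists>a \<in> carrier L. P = {q \<in> P. a \<sqsubseteq> q}"
        using le_p[OF pL] pL by blast
      show "P \<noteq> {}"
        using P p top_notin_pt inf_empty by metis
      fix A B
      assume "(\<exists>a \<in> carrier L. A = {q \<in> P. a \<sqsubseteq> q}) \<and> (\<exists>b \<in> carrier L. B = {q \<in> P. b \<sqsubseteq> q}) \<and>
        P = A \<union> B"
      then obtain a b where ab: "a \<in> carrier L" "b \<in> carrier L"
        and A: "A = {q \<in> P. a \<sqsubseteq> q}" and B: "B = {q \<in> P. b \<sqsubseteq> q}" and cover: "P = A \<union> B"
        by blast
      have "a \<sqinter> b \<sqsubseteq> q" if "q \<in> P" for q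
        using that cover P(1) ab unfolding A B by (subst meet_le_pt_iff) blast+
      then have "a \<sqinter> b \<sqsubseteq> p"
        using ab by (simp add: le_p)
      then have "a \<sqsubseteq> p \<or> b \<sqsubseteq> p"
        using ab p by (simp add: meet_le_pt_iff)
      then show "P = A \<or> P = B"
        using le_p ab unfolding A B by blast
    qed
    then obtain x where "x \<in> topspace ?X" "P = ?X closure_of {x}"
      using sober P(1) unfolding sober_space_def by meson
    then have x: "x \<in> P" and closure: "P = {q \<in> P. x \<sqsubseteq> q}"
      by (simp, metis closure_of_pt_subspace[OF P(1)] topspace_subtopology_subset
          topspace_pt_space[OF complete_lattice_axioms] P(1))
    have "x \<sqsubseteq> p"
      using le_p[of x] PL x closure by blast
    moreover have "p \<sqsubseteq> x"
      using le_p[OF pL] x pL by blast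
    ultimately show "p \<in> P"
      using x PL pL le_antisym by blast
  qed
  then show "weakly_covered L p"
    using p by (simp add: weakly_covered_def)
next
  assume wc: "\<forall>p \<in> pt L. weakly_covered L p"
  show "\<forall>Y \<subseteq> pt L. sober_space (subtopology (pt_space L) Y)"
    unfolding sober_space_def
  proof (intro allI impI)
    fix Y C
    let ?X = "subtopology (pt_space L) Y"
    assume Y: "Y \<subseteq> pt L" and irr: "irreducible_closed ?X C"
    note closed = closedin_pt_subspace[OF Y]
    have irrD: "C = A \<or> C = B" if "closedin ?X A" "closedin ?X B" "C = A \<union> B" for A B
    proof -
      have "\<forall>A B. closedin ?X A \<and> closedin ?X B \<and> C = A \<union> B \<longrightarrow> C = A \<or> C = B"
        using irr unfolding irreducible_closed_def by (elim conjE)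
      then show ?thesis
        using that by (elim allE[of _ A] allE[of _ B] impE) (intro conjI)
    qed
    obtain c where c: "c \<in> carrier L" "C = {q \<in> Y. c \<sqsubseteq> q}"
      using irr unfolding irreducible_closed_def closed by blast
    have CY: "C \<subseteq> Y" and CL: "C \<subseteq> carrier L"
      using c Y pt_subset by auto
    define p where "p = \<Sqinter>C"
    have pL: "p \<in> carrier L"
      using CL by (simp add: p_def)
    have le_p: "a \<sqsubseteq> p \<longleftrightarrow> (\<forall>q \<in> C. a \<sqsubseteq> q)" if "a \<in> carrier L" for a
      unfolding p_def using that CL by (rule le_infimum_iff[rotated])
    have "p \<in> pt L"
      unfolding pt_def
    proof (intro CollectI conjI ballI impI)
      show "p \<in> carrier L"
        by (rule pL)
      obtain q where q: "q \<in> C"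
        using irr by (auto simp: irreducible_closed_def)
      then have "p \<sqsubseteq> q" "q \<in> pt L"
        using le_p[OF pL] pL CY Y by auto
      then show "p \<noteq> \<top>"
        using top_notin_pt pt_closed by (metis le_antisym top_closed top_higher)
      fix a b assume ab: "a \<in> carrier L" "b \<in> carrier L" "a \<sqinter> b \<sqsubseteq> p"
      \<comment> \<open>Inside the closed set given by \<open>c\<close>, the closed set given by \<open>z\<close> is the one given by the join.\<close>
      have inter: "{q \<in> C. z \<sqsubseteq> q} = {q \<in> Y. c \<squnion> z \<sqsubseteq> q}" if z: "z \<in> carrier L" for z
      proof -
        have "c \<squnion> z \<sqsubseteq> q \<longleftrightarrow> c \<sqsubseteq> q \<and> z \<sqsubseteq> q" if "q \<in> carrier L" for q
        proof
          show "c \<squnion> z \<sqsubseteq> q" if "c \<sqsubseteq> q \<and> z \<sqsubseteq> q"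
            using that \<open>q \<in> carrier L\<close> z c(1) by (simp add: join_le)
          show "c \<sqsubseteq> q \<and> z \<sqsubseteq> q" if "c \<squnion> z \<sqsubseteq> q"
            using le_trans[OF join_left[OF c(1) z] that] le_trans[OF join_right[OF c(1) z] that]
              \<open>q \<in> carrier L\<close> z c(1) by simp
        qed
        moreover have "q \<in> carrier L" if "q \<in> Y" for q
          using that Y pt_closed by blast
        ultimately show ?thesis
          unfolding c(2) by auto
      qed
      have "a \<sqsubseteq> q \<or> b \<sqsubseteq> q" if "q \<in> C" for q
        using that ab CY Y le_p[of "a \<sqinter> b"] meet_le_pt_iff[of q a b] by auto
      then have cover: "C = {q \<in> C. a \<sqsubseteq> q} \<union> {q \<in> C. b \<sqsubseteq> q}"
        by blast
      have "closedin ?X {q \<in> C. z \<sqsubseteq> q}" if z: "z \<in> carrier L" for z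
        unfolding closed inter[OF z] by (rule bexI[of _ "c \<squnion> z"]) (use c(1) z in simp_all)
      then have "closedin ?X {q \<in> C. a \<sqsubseteq> q}" "closedin ?X {q \<in> C. b \<sqsubseteq> q}"
        using ab by simp_all
      then have "C = {q \<in> C. a \<sqsubseteq> q} \<or> C = {q \<in> C. b \<sqsubseteq> q}"
        using cover by (rule irrD)
      then show "a \<sqsubseteq> p \<or> b \<sqsubseteq> p"
        unfolding le_p[OF ab(1)] le_p[OF ab(2)] set_eq_iff mem_Collect_eq by blast
    qed
    then have "weakly_covered L p"
      using wc by blast
    moreover have "C \<subseteq> pt L"
      using CY Y by blast
    ultimately have pC: "p \<in> C"
      using p_def unfolding weakly_covered_def by blast
    have C_eq: "C = {q \<in> Y. p \<sqsubseteq> q}"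
    proof -
      have "c \<sqsubseteq> p"
        using pC c by blast
      then have "c \<sqsubseteq> q" if "q \<in> Y" "p \<sqsubseteq> q" for q
        using that Y c(1) pL pt_closed le_trans by blast
      then show ?thesis
        using c(2) le_p[OF pL] pL CY by blast
    qed
    have pY: "p \<in> Y"
      using pC CY by blast
    have top: "topspace ?X = Y"
      using Y topspace_pt_space[OF complete_lattice_axioms] by auto
    show "\<exists>!x. x \<in> topspace ?X \<and> C = ?X closure_of {x}"
      unfolding top
    proof (rule ex1I[of _ p])
      show "p \<in> Y \<and> C = ?X closure_of {p}"
        using pY C_eq closure_of_pt_subspace[OF Y] by simp
      fix x assume x: "x \<in> Y \<and> C = ?X closure_of {x}"
      then have xL: "x \<in> carrier L"
        using Y pt_closed by blast
      have "C = {q \<in> Y. x \<sqsubseteq> q}"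
        using x closure_of_pt_subspace[OF Y] by simp
      then have "x \<sqsubseteq> p" "p \<sqsubseteq> x"
        using C_eq x xL pY pL by blast+
      then show "x = p"
        using xL pL by (intro le_antisym)
    qed
  qed
qed

end

section \<open>Points of the frame of sublocales\<close>

context frame
begin

text \<open>The closed and the open sublocale given by an element \<open>a\<close> generate all of \<open>L\<close>, by
\<open>open_closed_decomposition\<close>, so a join-prime sublocale is contained in one of them.
This is what limits the size of join-prime sublocales.\<close>

lemma closed_sublocale:
  assumes a: "a \<in> carrier L"
  shows "is_sublocale L {x \<in> carrier L. a \<sqsubseteq> x}"
  unfolding is_sublocale_def
proof (intro conjI allI impI ballI)
  show "\<Sqinter>A \<in> {x \<in> carrier L. a \<sqsubseteq> x}" if "A \<subseteq> {x \<in> carrier L. a \<sqsubseteq> x}" for A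
  proof -
    have "A \<subseteq> carrier L"
      using that by blast
    then show ?thesis
      using that a le_infimum_iff[of A a] by auto
  qed
  show "himp L x s \<in> {x \<in> carrier L. a \<sqsubseteq> x}"
    if x: "x \<in> carrier L" and s: "s \<in> {x \<in> carrier L. a \<sqsubseteq> x}" for x s
    using x s a le_himp_iff[of x s a] le_trans[OF meet_left[OF a x], of s] by simp
qed auto

lemma open_sublocale:
  assumes a: "a \<in> carrier L"
  shows "is_sublocale L {x \<in> carrier L. himp L a x = x}"
  unfolding is_sublocale_def
proof (intro conjI allI impI ballI)
  show "\<Sqinter>A \<in> {x \<in> carrier L. himp L a x = x}" if A: "A \<subseteq> {x \<in> carrier L. himp L a x = x}" for A
  proof -
    have AL: "A \<subseteq> carrier L" and fixed: "\<And>s. s \<in> A \<Longrightarrow> himp L a s = s"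
      using A by auto
    have "himp L a (\<Sqinter>A) = \<Sqinter>A"
    proof (rule eq_by_lower)
      fix z assume z: "z \<in> carrier L"
      have "z \<sqsubseteq> himp L a (\<Sqinter>A) \<longleftrightarrow> (\<forall>s \<in> A. z \<sqinter> a \<sqsubseteq> s)"
        using a z AL by (simp add: le_himp_iff le_infimum_iff)
      also have "\<dots> \<longleftrightarrow> (\<forall>s \<in> A. z \<sqsubseteq> s)"
        using a z AL fixed by (metis le_himp_iff subsetD)
      finally show "z \<sqsubseteq> himp L a (\<Sqinter>A) \<longleftrightarrow> z \<sqsubseteq> \<Sqinter>A"
        using z AL by (simp add: le_infimum_iff)
    qed (use AL in simp_all)
    then show ?thesis
      using AL by simp
  qed
  show "himp L x s \<in> {x \<in> carrier L. himp L a x = x}"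
    if x: "x \<in> carrier L" and s: "s \<in> {x \<in> carrier L. himp L a x = x}" for x s
  proof -
    have sL: "s \<in> carrier L" and fixed: "himp L a s = s"
      using s by auto
    have "himp L a (himp L x s) = himp L x s"
    proof (rule eq_by_lower)
      fix z assume z: "z \<in> carrier L"
      have "z \<sqsubseteq> himp L a (himp L x s) \<longleftrightarrow> (z \<sqinter> a) \<sqinter> x \<sqsubseteq> s"
        using a x z sL by (simp add: le_himp_iff)
      also have "(z \<sqinter> a) \<sqinter> x = (z \<sqinter> x) \<sqinter> a"
        using a x z by (metis meet_assoc meet_comm)
      also have "\<dots> \<sqsubseteq> s \<longleftrightarrow> z \<sqinter> x \<sqsubseteq> s"
        using a x z sL le_himp_iff[of a s "z \<sqinter> x"] by (simp add: fixed)
      also have "\<dots> \<longleftrightarrow> z \<sqsubseteq> himp L x s"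
        using x z sL by (simp add: le_himp_iff)
      finally show "z \<sqsubseteq> himp L a (himp L x s) \<longleftrightarrow> z \<sqsubseteq> himp L x s" .
    qed simp_all
    then show ?thesis
      by simp
  qed
qed auto

lemma open_closed_decomposition:
  assumes a: "a \<in> carrier L" and x: "x \<in> carrier L"
  shows "(a \<squnion> x) \<sqinter> himp L a x = x"
proof (rule eq_by_lower)
  fix z assume z: "z \<in> carrier L"
  have ax: "a \<squnion> x \<in> carrier L"
    using a x by simp
  have "z \<sqsubseteq> (a \<squnion> x) \<sqinter> himp L a x \<longleftrightarrow> z \<sqsubseteq> a \<squnion> x \<and> z \<sqinter> a \<sqsubseteq> x"
    using a x z by (simp add: le_meet_iff le_himp_iff)
  also have "\<dots> \<longleftrightarrow> z \<sqsubseteq> x"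
  proof
    assume "z \<sqsubseteq> x"
    then show "z \<sqsubseteq> a \<squnion> x \<and> z \<sqinter> a \<sqsubseteq> x"
      using a x z ax by (meson join_right le_trans meet_closed meet_left)
  next
    assume le: "z \<sqsubseteq> a \<squnion> x \<and> z \<sqinter> a \<sqsubseteq> x"
    have "a \<sqsubseteq> himp L z x" "x \<sqsubseteq> himp L z x"
      using a x z le meet_left[OF x z] by (simp_all add: le_himp_iff meet_comm[of L a z])
    then have "a \<squnion> x \<sqsubseteq> himp L z x"
      using a x by (intro join_le) simp_all
    then have "z \<sqsubseteq> himp L z x"
      using le z ax by (meson himp_closed le_trans)
    then have "z \<sqinter> z \<sqsubseteq> x"
      using x z by (simp add: le_himp_iff)
    moreover have "z \<sqsubseteq> z \<sqinter> z"
      using z by (simp add: le_meet_iff)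
    ultimately show "z \<sqsubseteq> x"
      using x z by (meson le_trans meet_closed)
  qed
  finally show "z \<sqsubseteq> (a \<squnion> x) \<sqinter> himp L a x \<longleftrightarrow> z \<sqsubseteq> x" .
qed (use a x in simp_all)

lemma himp_idem:
  assumes a: "a \<in> carrier L" and x: "x \<in> carrier L"
  shows "himp L a (himp L a x) = himp L a x"
proof (rule eq_by_lower)
  fix z assume z: "z \<in> carrier L"
  have "z \<sqinter> a \<sqinter> a = z \<sqinter> a"
    using a z by (metis meet_assoc le_iff_join le_refl)
  then show "z \<sqsubseteq> himp L a (himp L a x) \<longleftrightarrow> z \<sqsubseteq> himp L a x"
    using a x z by (simp add: le_himp_iff)
qed simp_all

lemma sublocale_meet: "\<lbrakk>is_sublocale L S; x \<in> S; y \<in> S\<rbrakk> \<Longrightarrow> x \<sqinter> y \<in> S"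
  by (simp add: meet_def sublocale_inf)

text \<open>This set is the join of \<open>T\<close> and \<open>U\<close>, which turns join-primeness of sublocales into a
statement on elements.\<close>

lemma sublocale_binary_meets:
  assumes T: "is_sublocale L T" and U: "is_sublocale L U"
  shows "is_sublocale L {t \<sqinter> u |t u. t \<in> T \<and> u \<in> U}" (is "is_sublocale L ?V")
  unfolding is_sublocale_def
proof (intro conjI allI impI ballI)
  have TL: "T \<subseteq> carrier L" and UL: "U \<subseteq> carrier L"
    using T U by (auto dest: sublocale_closed)
  show VL: "?V \<subseteq> carrier L"
    using TL UL by (blast intro: meet_closed)
  show "\<Sqinter>A \<in> ?V" if A: "A \<subseteq> ?V" for A
  proof -
    define B where "B = {t \<in> T. \<exists>u \<in> U. t \<sqinter> u \<in> A}"
    define C where "C = {u \<in> U. \<exists>t \<in> T. t \<sqinter> u \<in> A}"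
    have BC: "B \<subseteq> T" "C \<subseteq> U" "B \<subseteq> carrier L" "C \<subseteq> carrier L" "A \<subseteq> carrier L"
      using TL UL subset_trans[OF A VL] by (auto simp: B_def C_def)
    have "\<Sqinter>A = \<Sqinter>B \<sqinter> \<Sqinter>C"
    proof (rule eq_by_lower)
      fix z assume z: "z \<in> carrier L"
      have "z \<sqsubseteq> \<Sqinter>B \<sqinter> \<Sqinter>C \<longleftrightarrow> (\<forall>t \<in> B. z \<sqsubseteq> t) \<and> (\<forall>u \<in> C. z \<sqsubseteq> u)"
        using z BC by (simp add: le_meet_iff le_infimum_iff)
      also have "\<dots> \<longleftrightarrow> (\<forall>t \<in> T. \<forall>u \<in> U. t \<sqinter> u \<in> A \<longrightarrow> z \<sqsubseteq> t \<and> z \<sqsubseteq> u)"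
        unfolding B_def C_def by blast
      also have "\<dots> \<longleftrightarrow> (\<forall>t \<in> T. \<forall>u \<in> U. t \<sqinter> u \<in> A \<longrightarrow> z \<sqsubseteq> t \<sqinter> u)"
        using z TL UL by (meson le_meet_iff subsetD)
      also have "\<dots> \<longleftrightarrow> (\<forall>a \<in> A. z \<sqsubseteq> a)"
        using A by blast
      finally show "z \<sqsubseteq> \<Sqinter>A \<longleftrightarrow> z \<sqsubseteq> \<Sqinter>B \<sqinter> \<Sqinter>C"
        using z BC by (simp add: le_infimum_iff)
    qed (use BC in simp_all)
    then show ?thesis
      using sublocale_inf[OF T BC(1)] sublocale_inf[OF U BC(2)] by blast
  qed
  show "himp L x s \<in> ?V" if x: "x \<in> carrier L" and s: "s \<in> ?V" for x s
  proof -
    obtain t u where tu: "t \<in> T" "u \<in> U" "s = t \<sqinter> u"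
      using s by blast
    have tuL: "t \<in> carrier L" "u \<in> carrier L"
      using tu TL UL by auto
    have "himp L x s = himp L x t \<sqinter> himp L x u"
      unfolding tu(3) using x tuL
      by (intro eq_by_lower) (simp_all add: le_himp_iff le_meet_iff)
    then show ?thesis
      using sublocale_himp[OF T x tu(1)] sublocale_himp[OF U x tu(2)] by blast
  qed
qed

lemma sublocales_simps:
  "carrier (sublocales L) = {S. is_sublocale L S}"
  "S \<sqsubseteq>\<^bsub>sublocales L\<^esub> T \<longleftrightarrow> S \<subseteq> T"
  by (simp_all add: sublocales_def)

lemma join_sublocales:
  assumes T: "is_sublocale L T" and U: "is_sublocale L U"
  shows "T \<squnion>\<^bsub>sublocales L\<^esub> U = {t \<sqinter> u |t u. t \<in> T \<and> u \<in> U}" (is "?J = ?V")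
proof
  interpret SL: complete_lattice "sublocales L"
    by (rule complete_lattice_sublocales) (rule frame_axioms)
  have V: "is_sublocale L ?V"
    by (rule sublocale_binary_meets[OF T U])
  have TL: "T \<subseteq> carrier L" and UL: "U \<subseteq> carrier L"
    using T U by (auto dest: sublocale_closed)
  have "t = t \<sqinter> \<top>" if "t \<in> T" for t
    using that TL le_iff_join[of t "\<top>"] by auto
  then have "T \<subseteq> ?V"
    using sublocale_top[OF U] by blast
  moreover have "u = \<top> \<sqinter> u" if "u \<in> U" for u
    using that UL le_iff_join[of u "\<top>"] meet_comm[of L u "\<top>"] by auto
  then have "U \<subseteq> ?V"
    using sublocale_top[OF T] by blast
  ultimately show "?J \<subseteq> ?V"
    using SL.join_le[where x = T and y = U and z = ?V] T U V by (simp add: sublocales_simps)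
  have J: "is_sublocale L ?J" "T \<subseteq> ?J" "U \<subseteq> ?J"
    using SL.join_closed[of T U] SL.join_left[of T U] SL.join_right[of T U] T U
    by (simp_all add: sublocales_simps)
  then show "?V \<subseteq> ?J"
    by (auto intro!: sublocale_meet[OF J(1)])
qed

lemma bottom_sublocales: "\<bottom>\<^bsub>sublocales L\<^esub> = {\<top>}"
proof -
  interpret SL: complete_lattice "sublocales L"
    by (rule complete_lattice_sublocales) (rule frame_axioms)
  have "meet_span L {} = {\<top>}"
    by (simp add: meet_span_def inf_empty)
  then have "is_sublocale L {\<top>}"
    using sublocale_meet_span[of "{}"] by simp
  then show ?thesis
    using SL.bottom_closed SL.bottom_lower[of "{\<top>}"] sublocale_top
    by (simp add: sublocales_simps) blast
qed

lemma meet_span_singleton: "p \<in> carrier L \<Longrightarrow> meet_span L {p} = {p, \<top>}"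
  by (auto simp: meet_span_def inf_empty subset_singleton_iff intro: exI[of _ "{}"] exI[of _ "{p}"])

text \<open>A join-prime sublocale \<open>S\<close> with least element \<open>p\<close> is contained in the closed or in the
open sublocale of each \<open>a \<in> S\<close>. The first case gives \<open>a = p\<close>, as \<open>p \<in> S\<close>. In
the second case \<open>a\<close> equals \<open>a \<rightarrow> a\<close>, which is the top element. So
\<open>S = {p, \<top>}\<close>, and closure of \<open>S\<close> under implication makes \<open>p\<close> prime.\<close>

lemma pt_dual_sublocales: "pt (inv_gorder (sublocales L)) = (\<lambda>p. {p, \<top>}) ` pt L"
proof -
  have mem: "S \<in> pt (inv_gorder (sublocales L)) \<longleftrightarrow> is_sublocale L S \<and> S \<noteq> {\<top>} \<and>
      (\<forall>T U. is_sublocale L T \<and> is_sublocale L U \<and> S \<subseteq> {t \<sqinter> u |t u. t \<in> T \<and> u \<in> U} \<longrightarrow>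
        S \<subseteq> T \<or> S \<subseteq> U)" for S
  proof -
    have "S \<in> pt (inv_gorder (sublocales L)) \<longleftrightarrow> is_sublocale L S \<and> S \<noteq> {\<top>} \<and>
      (\<forall>T \<in> {T. is_sublocale L T}. \<forall>U \<in> {T. is_sublocale L T}.
        S \<subseteq> T \<squnion>\<^bsub>sublocales L\<^esub> U \<longrightarrow> S \<subseteq> T \<or> S \<subseteq> U)"
      unfolding pt_def meet_dual top_dual bottom_sublocales by (simp add: sublocales_simps)
    also have "\<dots> \<longleftrightarrow> is_sublocale L S \<and> S \<noteq> {\<top>} \<and>
      (\<forall>T U. is_sublocale L T \<and> is_sublocale L U \<and> S \<subseteq> {t \<sqinter> u |t u. t \<in> T \<and> u \<in> U} \<longrightarrow>
        S \<subseteq> T \<or> S \<subseteq> U)"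
      using join_sublocales by (metis (no_types, lifting) mem_Collect_eq)
    finally show ?thesis .
  qed
  show ?thesis
  proof (intro equalityI subsetI)
    fix S assume "S \<in> pt (inv_gorder (sublocales L))"
    then have S: "is_sublocale L S" and nontrivial: "S \<noteq> {\<top>}"
      and prime: "\<And>T U. \<lbrakk>is_sublocale L T; is_sublocale L U; S \<subseteq> {t \<sqinter> u |t u. t \<in> T \<and> u \<in> U}\<rbrakk>
        \<Longrightarrow> S \<subseteq> T \<or> S \<subseteq> U"
      unfolding mem by blast+
    have SL: "S \<subseteq> carrier L"
      by (rule sublocale_closed[OF S])
    define p where "p = \<Sqinter>S"
    have pS: "p \<in> S" and pL: "p \<in> carrier L"
      using sublocale_inf[OF S] SL by (auto simp: p_def)
    have p_le: "p \<sqsubseteq> s" if "s \<in> S" for s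
      unfolding p_def using that SL by (intro inf_lower)
    have "a = p \<or> a = \<top>" if aS: "a \<in> S" for a
    proof -
      have a: "a \<in> carrier L"
        using aS SL by blast
      let ?T = "{x \<in> carrier L. a \<sqsubseteq> x}" and ?U = "{x \<in> carrier L. himp L a x = x}"
      have "S \<subseteq> {t \<sqinter> u |t u. t \<in> ?T \<and> u \<in> ?U}"
      proof
        fix x assume "x \<in> S"
        then have x: "x \<in> carrier L"
          using SL by blast
        then have "a \<squnion> x \<in> ?T" "himp L a x \<in> ?U"
          using a by (simp_all add: join_left himp_idem)
        then show "x \<in> {t \<sqinter> u |t u. t \<in> ?T \<and> u \<in> ?U}"
          using open_closed_decomposition[OF a x, symmetric] by blast
      qed
      then have "S \<subseteq> ?T \<or> S \<subseteq> ?U"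
        by (intro prime closed_sublocale[OF a] open_sublocale[OF a])
      then show ?thesis
      proof
        assume "S \<subseteq> ?T"
        then show ?thesis
          using pS p_le[OF aS] a pL by (auto intro: le_antisym)
      next
        assume "S \<subseteq> ?U"
        then have "himp L a a = a"
          using aS by blast
        moreover have "\<top> \<sqsubseteq> himp L a a"
          using a by (simp add: le_himp_iff meet_right)
        ultimately show ?thesis
          using a by (metis le_antisym top_closed top_higher)
      qed
    qed
    then have S_eq: "S = {p, \<top>}"
      using pS sublocale_top[OF S] by blast
    have "p \<in> pt L"
      unfolding pt_def
    proof (intro CollectI conjI ballI impI)
      show "p \<in> carrier L"
        by (rule pL)
      show "p \<noteq> \<top>"
        using nontrivial S_eq by blast
      fix x y assume x: "x \<in> carrier L" and y: "y \<in> carrier L" and xy: "x \<sqinter> y \<sqsubseteq> p"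
      have "himp L x p = p \<or> himp L x p = \<top>"
        using sublocale_himp[OF S x pS] S_eq by blast
      then show "x \<sqsubseteq> p \<or> y \<sqsubseteq> p"
      proof
        assume "himp L x p = p"
        then show ?thesis
          using le_himp_iff[OF x pL y] x y xy by (simp add: meet_comm)
      next
        assume "himp L x p = \<top>"
        then have "x \<sqinter> x \<sqsubseteq> p"
          using le_himp_iff[OF x pL x] x by simp
        moreover have "x \<sqsubseteq> x \<sqinter> x"
          using x by (simp add: le_meet_iff)
        ultimately show ?thesis
          using x pL by (meson le_trans meet_closed)
      qed
    qed
    then show "S \<in> (\<lambda>p. {p, \<top>}) ` pt L"
      using S_eq by blast
  next
    fix S assume "S \<in> (\<lambda>p. {p, \<top>}) ` pt L"
    then obtain p where p: "p \<in> pt L" and S_eq: "S = {p, \<top>}"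
      by blast
    have pL: "p \<in> carrier L" and ptop: "p \<noteq> \<top>"
      using p by (auto simp: pt_def)
    have "is_sublocale L S"
      using sublocale_meet_span[of "{p}"] p meet_span_singleton[OF pL] S_eq by simp
    moreover have "S \<subseteq> T \<or> S \<subseteq> U"
      if T: "is_sublocale L T" and U: "is_sublocale L U"
        and le: "S \<subseteq> {t \<sqinter> u |t u. t \<in> T \<and> u \<in> U}" for T U
    proof -
      obtain t u where tu: "t \<in> T" "u \<in> U" "p = t \<sqinter> u"
        using le S_eq by blast
      have tuL: "t \<in> carrier L" "u \<in> carrier L"
        using tu T U by (auto dest: sublocale_closed)
      have "t \<sqsubseteq> p \<or> u \<sqsubseteq> p"
        using meet_le_pt_iff[OF p tuL] tu(3) pL by auto
      moreover have "p \<sqsubseteq> t" "p \<sqsubseteq> u"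
        using tu(3) tuL meet_left meet_right by auto
      ultimately have "t = p \<or> u = p"
        using pL tuL by (auto intro: le_antisym)
      then show ?thesis
        using tu(1,2) sublocale_top[OF T] sublocale_top[OF U] S_eq by blast
    qed
    ultimately show "S \<in> pt (inv_gorder (sublocales L))"
      unfolding mem using S_eq ptop by blast
  qed
qed

text \<open>In the opposite order, the open set of \<open>S\<close> consists of the points not contained in
\<open>S\<close>. As every sublocale contains the top element, \<open>{p, \<top>}\<close> is such a point iff
\<open>p \<notin> S\<close>.\<close>

lemma openin_pt_dual_sublocales:
  "openin (pt_space (inv_gorder (sublocales L))) U \<longleftrightarrow>
    (\<exists>S. is_sublocale L S \<and> U = (\<lambda>p. {p, \<top>}) ` (pt L - S))"
proof -
  have dual: "complete_lattice (inv_gorder (sublocales L))"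
    by (intro complete_lattice_dual complete_lattice_sublocales frame_axioms)
  have points: "{Q \<in> (\<lambda>p. {p, \<top>}) ` pt L. \<not> Q \<subseteq> S} = (\<lambda>p. {p, \<top>}) ` (pt L - S)"
    if "is_sublocale L S" for S
    using sublocale_top[OF that] by blast
  have "openin (pt_space (inv_gorder (sublocales L))) U \<longleftrightarrow>
      (\<exists>S. is_sublocale L S \<and> U = {Q \<in> (\<lambda>p. {p, \<top>}) ` pt L. \<not> Q \<subseteq> S})"
    unfolding openin_pt_space[OF dual] pt_dual_sublocales by (simp add: sublocales_simps)
  then show ?thesis
    using points by (metis (no_types, lifting))
qed

text \<open>Discreteness says that every set of primes is the complement of the primes of some sublocale. For
\<open>{p}\<close> this gives a sublocale that contains all primes except \<open>p\<close>, hence all meets of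
such primes.\<close>

lemma discrete_pt_dual_sublocales_iff:
  "pt_space (inv_gorder (sublocales L)) = discrete_topology (pt (inv_gorder (sublocales L)))
    \<longleftrightarrow> (\<forall>p \<in> pt L. weakly_covered L p)"
proof -
  let ?b = "\<lambda>p. {p, \<top>}"
  have inj: "inj_on ?b (pt L)"
    using top_notin_pt by (auto simp: inj_on_def doubleton_eq_iff)
  have "pt_space (inv_gorder (sublocales L)) = discrete_topology (pt (inv_gorder (sublocales L)))
      \<longleftrightarrow> (\<forall>U. (\<exists>S. is_sublocale L S \<and> U = ?b ` (pt L - S)) \<longleftrightarrow> U \<subseteq> ?b ` pt L)"
    unfolding topology_eq openin_discrete_topology openin_pt_dual_sublocales pt_dual_sublocales ..
  also have "\<dots> \<longleftrightarrow> (\<forall>P \<subseteq> pt L. \<exists>S. is_sublocale L S \<and> P = pt L - S)"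
  proof -
    have "?b ` P = ?b ` Q \<longleftrightarrow> P = Q" if "P \<subseteq> pt L" "Q \<subseteq> pt L" for P Q
      using inj that by (rule inj_on_image_eq_iff)
    then have "(\<forall>P \<subseteq> pt L. \<exists>S. is_sublocale L S \<and> ?b ` P = ?b ` (pt L - S))
        \<longleftrightarrow> (\<forall>P \<subseteq> pt L. \<exists>S. is_sublocale L S \<and> P = pt L - S)"
      by (metis Diff_subset)
    moreover have "(\<forall>U. (\<exists>S. is_sublocale L S \<and> U = ?b ` (pt L - S)) \<longleftrightarrow> U \<subseteq> ?b ` pt L)
        \<longleftrightarrow> (\<forall>U \<subseteq> ?b ` pt L. \<exists>S. is_sublocale L S \<and> U = ?b ` (pt L - S))"
      by blast
    moreover have "\<dots> \<longleftrightarrow> (\<forall>P \<subseteq> pt L. \<exists>S. is_sublocale L S \<and> ?b ` P = ?b ` (pt L - S))"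
      by (rule all_subset_image)
    ultimately show ?thesis
      by simp
  qed
  also have "\<dots> \<longleftrightarrow> (\<forall>p \<in> pt L. weakly_covered L p)"
  proof (intro iffI ballI allI impI)
    fix p assume all: "\<forall>P \<subseteq> pt L. \<exists>S. is_sublocale L S \<and> P = pt L - S" and p: "p \<in> pt L"
    then obtain S where S: "is_sublocale L S" "{p} = pt L - S"
      by (metis empty_subsetI insert_subset)
    have "p \<in> P" if "P \<subseteq> pt L" "p \<in> meet_span L P" for P
    proof (rule ccontr)
      assume "p \<notin> P"
      moreover have "q = p \<or> q \<in> S" if "q \<in> pt L" for q
        using that S(2) by (metis DiffI singletonD)
      ultimately have "P \<subseteq> S"
        using that(1) by (metis subsetD subsetI)
      then have "p \<in> S"
        using meet_span_least[OF S(1)] that by blast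
      then show False
        using S by blast
    qed
    then show "weakly_covered L p"
      using weakly_covered_iff[OF p] by blast
  next
    fix P assume wc: "\<forall>p \<in> pt L. weakly_covered L p" and P: "P \<subseteq> pt L"
    have "pt L \<inter> meet_span L (pt L - P) = pt L - P"
      using wc by (rule weakly_covered_pt_meet_span) blast
    then have "P = pt L - meet_span L (pt L - P)"
      using P by blast
    then show "\<exists>S. is_sublocale L S \<and> P = pt L - S"
      using sublocale_meet_span[OF Diff_subset] by blast
  qed
  finally show ?thesis .
qed

end

section \<open>The coframe of spatial sublocales\<close>

context frame
begin

lemma spatial_sublocales_le: "S \<sqsubseteq>\<^bsub>spatial_sublocales L\<^esub> T \<longleftrightarrow> S \<subseteq> T"
  by (simp add: spatial_sublocales_def)

lemma pt_order_iso:
  assumes wc: "\<forall>p \<in> pt L. weakly_covered L p"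
  shows "gorder_iso (spatial_sublocales L) (powerset_order (pt L)) (\<lambda>S. pt L \<inter> S)"
proof -
  interpret A: partial_order "spatial_sublocales L"
    by (rule partial_order_spatial_sublocales)
  interpret B: partial_order "powerset_order (pt L)"
    by (rule partial_order_powerset)
  note pt_span = weakly_covered_pt_meet_span[OF wc]
  show ?thesis
  proof unfold_locales
    show "bij_betw (\<lambda>S. pt L \<inter> S) (carrier (spatial_sublocales L)) (carrier (powerset_order (pt L)))"
      unfolding carrier_spatial_sublocales powerset_order_simps
      by (rule bij_betw_byWitness[where f' = "meet_span L"]) (auto simp: pt_span)
    fix S T assume "S \<in> carrier (spatial_sublocales L)" "T \<in> carrier (spatial_sublocales L)"
    then obtain P Q where "P \<subseteq> pt L" "S = meet_span L P" "Q \<subseteq> pt L" "T = meet_span L Q"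
      unfolding carrier_spatial_sublocales by blast
    then have "pt L \<inter> S = P" "pt L \<inter> T = Q" "P \<subseteq> Q \<longrightarrow> S \<subseteq> T"
      using pt_span[of P] pt_span[of Q] meet_span_mono[of P Q] by simp_all
    then have "pt L \<inter> S = P" "pt L \<inter> T = Q" "P \<subseteq> Q \<longleftrightarrow> S \<subseteq> T"
      by blast+
    then show "pt L \<inter> S \<sqsubseteq>\<^bsub>powerset_order (pt L)\<^esub> pt L \<inter> T \<longleftrightarrow> S \<sqsubseteq>\<^bsub>spatial_sublocales L\<^esub> T"
      by (simp add: powerset_order_simps spatial_sublocales_le)
  qed
qed

lemma pt_coframe_iso_iff:
  "(\<lambda>S. pt L \<inter> S) \<in> coframe_iso (spatial_sublocales L) (powerset_order (pt L))
    \<longleftrightarrow> (\<forall>p \<in> pt L. weakly_covered L p)"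
proof (intro iffI ballI)
  assume wc: "\<forall>p \<in> pt L. weakly_covered L p"
  show "(\<lambda>S. pt L \<inter> S) \<in> coframe_iso (spatial_sublocales L) (powerset_order (pt L))"
    by (rule gorder_iso.coframe_iso_of_order_iso[OF pt_order_iso[OF wc]
          complete_lattice_powerset coframe_powerset])
next
  fix p assume iso: "(\<lambda>S. pt L \<inter> S) \<in> coframe_iso (spatial_sublocales L) (powerset_order (pt L))"
    and p: "p \<in> pt L"
  have surj: "(\<lambda>S. pt L \<inter> S) ` carrier (spatial_sublocales L) = Pow (pt L)"
    using iso by (simp add: coframe_iso_def bij_betw_def powerset_order_simps)
  have "p \<in> P" if P: "P \<subseteq> pt L" "p \<in> meet_span L P" for P
  proof -
    have "P \<in> (\<lambda>S. pt L \<inter> S) ` carrier (spatial_sublocales L)"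
      using surj P by simp
    then obtain S where S: "S \<in> carrier (spatial_sublocales L)" "P = pt L \<inter> S"
      by blast
    then have "is_sublocale L S"
      by (simp add: spatial_sublocales_def)
    then have "p \<in> S"
      using meet_span_least S(2) P(2) by blast
    then show ?thesis
      using p S(2) by blast
  qed
  then show "weakly_covered L p"
    using weakly_covered_iff[OF p] by blast
qed

text \<open>Only the complement \<open>T\<close> of the sublocale \<open>{p, \<top>}\<close> matters. It omits \<open>p\<close>, as its
meet with \<open>{p, \<top>}\<close> is trivial. A prime \<open>q\<close> strictly above \<open>p\<close> is a meet of
primes of \<open>T\<close> and possibly \<open>p\<close>, as the join is everything, and \<open>p\<close> cannot take
part in that meet. So \<open>T\<close> contains all primes strictly above \<open>p\<close> and all their meets.\<close>

lemma boolean_spatial_sublocales_iff: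
  "boolean_lattice (spatial_sublocales L) \<longleftrightarrow> (\<forall>p \<in> pt L. weakly_covered L p)"
proof (intro iffI ballI)
  assume wc: "\<forall>p \<in> pt L. weakly_covered L p"
  show "boolean_lattice (spatial_sublocales L)"
    by (rule gorder_iso.boolean_lattice_transfer[OF pt_order_iso[OF wc]
          complete_lattice_powerset boolean_lattice_powerset])
next
  fix p assume "boolean_lattice (spatial_sublocales L)" and p: "p \<in> pt L"
  then interpret B: boolean_lattice "spatial_sublocales L"
    by simp
  have pL: "p \<in> carrier L"
    by (rule pt_closed[OF p])
  have span: "meet_span L P \<in> carrier (spatial_sublocales L)" if "P \<subseteq> pt L" for P
    using that unfolding carrier_spatial_sublocales by blast
  let ?S = "meet_span L {p}"
  have S: "?S \<in> carrier (spatial_sublocales L)" and pS: "p \<in> ?S"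
    using p pL by (blast intro: span, simp add: meet_span_singleton)
  obtain T where T: "T \<in> carrier (spatial_sublocales L)"
    and meet: "?S \<sqinter>\<^bsub>spatial_sublocales L\<^esub> T = \<bottom>\<^bsub>spatial_sublocales L\<^esub>"
    and join: "?S \<squnion>\<^bsub>spatial_sublocales L\<^esub> T = \<top>\<^bsub>spatial_sublocales L\<^esub>"
    using B.complement_exists[OF S] by blast
  obtain Q where Q: "Q \<subseteq> pt L" "T = meet_span L Q"
    using T unfolding carrier_spatial_sublocales by blast
  have Tsub: "is_sublocale L T"
    using T by (simp add: spatial_sublocales_def)
  have pT: "p \<notin> T"
  proof
    assume "p \<in> T"
    then have "?S \<subseteq> T"
      using meet_span_least[OF Tsub] by blast
    then have "?S \<subseteq> \<bottom>\<^bsub>spatial_sublocales L\<^esub>"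
      using B.meet_le[where x = ?S and y = T and z = ?S] S T meet by (simp add: spatial_sublocales_le)
    also have "\<dots> \<subseteq> meet_span L {}"
      using B.bottom_lower[OF span[of "{}"]] by (simp add: spatial_sublocales_le)
    finally show False
      using pS p top_notin_pt by (auto simp: meet_span_def inf_empty)
  qed
  have Qp: "insert p Q \<subseteq> pt L"
    using p Q by blast
  have all_primes: "pt L \<subseteq> meet_span L (insert p Q)"
  proof -
    have "pt L \<subseteq> meet_span L (pt L)"
      by (rule subset_meet_span[OF pt_subset])
    also have "\<dots> \<subseteq> \<top>\<^bsub>spatial_sublocales L\<^esub>"
      using B.top_higher[OF span[OF subset_refl]] by (simp add: spatial_sublocales_le)
    also have "\<dots> \<subseteq> meet_span L (insert p Q)"
      using B.join_le[where x = ?S and y = T and z = "meet_span L (insert p Q)"] S T span[OF Qp] join Q(2)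
        meet_span_mono[of "{p}" "insert p Q"] meet_span_mono[of Q "insert p Q"]
      by (auto simp: spatial_sublocales_le)
    finally show ?thesis .
  qed
  have "q \<in> T" if q: "q \<in> pt L" "p \<sqsubseteq> q" "q \<noteq> p" for q
  proof -
    obtain R where R: "R \<subseteq> insert p Q" "q = \<Sqinter>R"
      using q(1) all_primes by (auto simp: meet_span_def)
    have RL: "R \<subseteq> carrier L"
      using R(1) Qp pt_subset by blast
    have "p \<notin> R"
    proof
      assume "p \<in> R"
      then have "q \<sqsubseteq> p"
        unfolding R(2) by (rule inf_lower[OF RL])
      then show False
        using q pL pt_closed le_antisym by blast
    qed
    then show ?thesis
      using R Q(2) by (auto simp: meet_span_def)
  qed
  then have "p \<in> P" if P: "P \<subseteq> pt L" "p = \<Sqinter>P" for P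
  proof -
    have "p \<sqsubseteq> q" if "q \<in> P" for q
      unfolding P(2) using P(1) pt_subset that by (intro inf_lower) auto
    then have "P \<subseteq> T" if "p \<notin> P"
      using that P(1) \<open>\<And>q. \<lbrakk>q \<in> pt L; p \<sqsubseteq> q; q \<noteq> p\<rbrakk> \<Longrightarrow> q \<in> T\<close> by blast
    then show ?thesis
      using sublocale_inf[OF Tsub] P(2) pT by metis
  qed
  then show "weakly_covered L p"
    using p by (simp add: weakly_covered_def)
qed

end

section \<open>The equivalences\<close>

theorem theorem5p9:
  fixes L :: "('a, 'b) gorder_scheme"
  assumes "frame L"
  defines "C1 \<equiv> \<forall>p \<in> pt L. weakly_covered L p"
    and "C2 \<equiv> \<forall>Y \<subseteq> pt L. sober_space (subtopology (pt_space L) Y)"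
    and "C3 \<equiv> (\<lambda>S. pt L \<inter> S) \<in> coframe_iso (spatial_sublocales L) (powerset_order (pt L))"
    and "C4 \<equiv> pt_space (inv_gorder (sublocales L))
                 = discrete_topology (pt (inv_gorder (sublocales L)))"
    and "C5 \<equiv> TD_space (pt_space L)"
    and "C6 \<equiv> boolean_lattice (spatial_sublocales L)"
  shows "(C1 \<longleftrightarrow> C2) \<and> (C2 \<longleftrightarrow> C3) \<and> (C3 \<longleftrightarrow> C4) \<and> (C4 \<longleftrightarrow> C5) \<and> (C5 \<longleftrightarrow> C6)"
proof -
  interpret frame L by fact
  show ?thesis
    unfolding C1_def C2_def C3_def C4_def C5_def C6_def
      sober_subspaces_pt_iff pt_coframe_iso_iff discrete_pt_dual_sublocales_iff
      TD_space_pt_iff boolean_spatial_sublocales_iff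
    by simp
qed

end
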